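(* Let $K$ be a number field and $c\in K$. For every $P\in K$ that is preperiodic for $f_c(z)=z^2+c$ (i.e. has finite forward orbit), \[H_K(P)\le\left(\frac{1+\sqrt5}{2}\right)^{[K:\mathbb Q]}H_K(c)^{1/2}.\]
   Context: $M_K$ is the set of places of $K$. For an archimedean place $v$ with embedding $\sigma_v:K\hookrightarrow\mathbb C$, $|x|_v=|\sigma_v(x)|$; for a finite place $v$ corresponding to a prime $\mathfrak p$, $|x|_v=N(\mathfrak p)^{-\operatorname{ord}_{\mathfrak p}(x)/(e(\mathfrak p)f(\mathfrak p))}$, with $N,e,f$ the norm, ramification index and residue degree. The relative height is $H_K(x)=\prod_{v\in M_K}\max\{|x|_v,1\}^{n_v}$ with $n_v=[K_v:\mathbb Q_v]$. *)

theory Defs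
  imports Complex_Main "HOL-Algebra.Algebra" "HOL-Algebra.Algebraic_Closure_Type"
    "HOL-Computational_Algebra.Computational_Algebra"
begin

text \<open>
  A number field is a type of class \<open>field_char_0\<close> that is finite-dimensional over its
  subfield \<open>\<rat>\<close>. The record \<open>ring_of_type_algebra\<close> regards it as a ring in the sense of
  HOL-Algebra, so that ideals, quotients and degrees are the ones of that library.
\<close>

definition number_field :: "'a::field_char_0 itself \<Rightarrow> bool" where
  "number_field _ \<longleftrightarrow>
     ring.finite_dimension (ring_of_type_algebra :: 'a ring) \<rat> UNIV"

definition field_degree :: "'a::field_char_0 itself \<Rightarrow> nat" where
  "field_degree _ = ring.dim (ring_of_type_algebra :: 'a ring) \<rat> UNIV"


subsection \<open>Prime ideals of the ring of integers\<close>

definition ring_of_integers :: "'a::field_char_0 ring" where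
  "ring_of_integers = ring_of_type_algebra \<lparr>carrier := {x. algebraic_int x}\<rparr>"

definition finite_primes :: "'a::field_char_0 set set" where
  "finite_primes = {\<pp>. primeideal \<pp> ring_of_integers \<and> \<pp> \<noteq> {0}}"

definition ideal_norm :: "'a::field_char_0 set \<Rightarrow> nat" where
  "ideal_norm \<pp> = Coset.order (ring_of_integers Quot \<pp>)"

definition residue_char :: "'a::field_char_0 set \<Rightarrow> nat" where
  "residue_char \<pp> = (THE l. Factorial_Ring.prime l \<and> of_nat l \<in> \<pp>)"

definition residue_degree :: "'a::field_char_0 set \<Rightarrow> nat" where
  "residue_degree \<pp> =
     (let k = ring_of_integers Quot \<pp>
      in ring.dim k (range (\<lambda>m. \<pp> +>\<^bsub>ring_of_integers\<^esub> of_int m)) (carrier k))"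

text \<open>
  The powers of \<open>\<pp>\<close> are taken in the multiplicative monoid of ideals. The order of a nonzero
  integer \<open>a\<close> is the largest \<open>n\<close> such that \<open>\<pp>\<^sup>n\<close> divides, i.e. contains, the ideal \<open>(a)\<close>;
  for a quotient \<open>a / b\<close> of integers it is the difference of the orders.
\<close>

definition ord_integer :: "'a::field_char_0 set \<Rightarrow> 'a \<Rightarrow> nat" where
  "ord_integer \<pp> a = (GREATEST n. a \<in> \<pp> [^]\<^bsub>ideals_set ring_of_integers\<^esub> (n::nat))"

definition ord_prime :: "'a::field_char_0 set \<Rightarrow> 'a \<Rightarrow> int" where
  "ord_prime \<pp> x =
     (THE k. \<exists>a\<in>carrier ring_of_integers. \<exists>b\<in>carrier ring_of_integers.
        a \<noteq> 0 \<and> b \<noteq> 0 \<and> x = a / b \<and> k = int (ord_integer \<pp> a) - int (ord_integer \<pp> b))"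

definition ramification_index :: "'a::field_char_0 set \<Rightarrow> nat" where
  "ramification_index \<pp> = ord_integer \<pp> (of_nat (residue_char \<pp>))"


subsection \<open>Places\<close>

text \<open>
  An archimedean place is an embedding into \<open>\<complex>\<close> up to complex conjugation, represented by the
  set \<open>{\<sigma>, cnj \<circ> \<sigma>}\<close>; a finite place is a nonzero prime ideal of the ring of integers.
\<close>

datatype 'a place = Arch_Place "('a \<Rightarrow> complex) set" | Fin_Place "'a set"

definition embeddings :: "('a::field_char_0 \<Rightarrow> complex) set" where
  "embeddings = ring_hom ring_of_type_algebra ring_of_type_algebra"

definition places :: "'a::field_char_0 place set" where
  "places = {Arch_Place {\<sigma>, cnj \<circ> \<sigma>} | \<sigma>. \<sigma> \<in> embeddings} \<union> Fin_Place ` finite_primes"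

fun place_abs :: "'a::field_char_0 place \<Rightarrow> 'a \<Rightarrow> real" where
  "place_abs (Arch_Place S) x = cmod ((SOME \<sigma>. \<sigma> \<in> S) x)"
| "place_abs (Fin_Place \<pp>) x =
     (if x = 0 then 0
      else real (ideal_norm \<pp>) powr
        (- real_of_int (ord_prime \<pp> x) / (real (ramification_index \<pp>) * real (residue_degree \<pp>))))"


subsection \<open>Completions and local degrees\<close>

text \<open>
  The completion \<open>K\<^sub>v\<close> is the ring of Cauchy sequences modulo the null sequences. The completion
  \<open>\<rat>\<^sub>v\<close> of \<open>\<rat>\<close> under the restriction of \<open>v\<close> is realised inside \<open>K\<^sub>v\<close>, as the set of classes of
  Cauchy sequences of rational numbers.
\<close>

definition cauchy_ring :: "'a::field_char_0 place \<Rightarrow> (nat \<Rightarrow> 'a) ring" where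
  "cauchy_ring v =
     \<lparr>carrier = {s. \<forall>\<epsilon>>0. \<exists>N. \<forall>m\<ge>N. \<forall>n\<ge>N. place_abs v (s m - s n) < \<epsilon>},
      monoid.mult = (\<lambda>s t n. s n * t n),
      one = (\<lambda>_. 1),
      ring.zero = (\<lambda>_. 0),
      add = (\<lambda>s t n. s n + t n)\<rparr>"

definition null_seqs :: "'a::field_char_0 place \<Rightarrow> (nat \<Rightarrow> 'a) set" where
  "null_seqs v = {s. (\<lambda>n. place_abs v (s n)) \<longlonglongrightarrow> 0}"

definition completion :: "'a::field_char_0 place \<Rightarrow> (nat \<Rightarrow> 'a) set ring" where
  "completion v = cauchy_ring v Quot null_seqs v"

definition completion_rats :: "'a::field_char_0 place \<Rightarrow> (nat \<Rightarrow> 'a) set set" where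
  "completion_rats v =
     (\<lambda>s. null_seqs v +>\<^bsub>cauchy_ring v\<^esub> s) ` {s \<in> carrier (cauchy_ring v). range s \<subseteq> \<rat>}"

definition local_degree :: "'a::field_char_0 place \<Rightarrow> nat" where
  "local_degree v = ring.dim (completion v) (completion_rats v) (carrier (completion v))"


subsection \<open>Height and preperiodic points\<close>

text \<open>
  All but finitely many factors of the height are equal to \<open>1\<close>; \<open>prod'\<close> is the product of the
  factors different from \<open>1\<close>, whereas \<open>prod\<close> over the infinite set of places would be \<open>1\<close>.
\<close>

definition rel_height :: "'a::field_char_0 \<Rightarrow> real" where
  "rel_height x = prod' (\<lambda>v. max (place_abs v x) 1 ^ local_degree v) places"

definition preperiodic :: "('b \<Rightarrow> 'b) \<Rightarrow> 'b \<Rightarrow> bool" where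
  "preperiodic f P \<longleftrightarrow> finite (range (\<lambda>n. (f ^^ n) P))"

end

theory Submission
  imports Defs "Jordan_Normal_Form.Char_Poly"
begin

text \<open>
  Let \<open>M\<close> be the maximal absolute value at a place \<open>v\<close> of the finitely many points of the orbit of
  \<open>P\<close>. The square of a point differs from an orbit point by \<open>c\<close>, so \<open>M\<^sup>2 \<le> max M \<bar>c\<bar>\<close> if \<open>v\<close> is finite
  and \<open>M\<^sup>2 \<le> M + \<bar>c\<bar>\<close> if \<open>v\<close> is archimedean. Hence \<open>max \<bar>P\<bar> 1\<close> is at most \<open>max \<bar>c\<bar> 1\<close> to the power
  \<open>1 / 2\<close>, times the golden ratio if \<open>v\<close> is archimedean; the local degrees of the archimedean
  places add up to at most the degree of the field, because each of them is the number of embeddings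
  that belong to the place.

  At the finite places the orders are valuations because the inverse of a prime \<open>\<pp>\<close> contains an
  element \<open>g\<close> with \<open>g\<pp>\<close> not contained in \<open>\<pp>\<close>, so that \<open>\<pp>\<^sup>n\<close> consists of the integers \<open>a\<close> for which
  \<open>g\<^sup>n a\<close> is an integer. The existence of \<open>g\<close>, like the finiteness of the set of primes at which
  \<open>\<bar>c\<bar> > 1\<close>, follows from the finiteness of the ring of integers modulo a positive number \<open>m\<close>.
\<close>

section \<open>Algebraic integers\<close>

text \<open>Such a \<open>z\<close> is an eigenvalue of an integer matrix, hence a root of its
  characteristic polynomial, which is monic with integer coefficients.\<close>

lemma algebraic_int_if_eigenvalue:
  fixes z :: "'a :: field_char_0" and v :: "nat \<Rightarrow> 'a" and A :: "nat \<Rightarrow> nat \<Rightarrow> int"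
  assumes A: "\<And>i. i < n \<Longrightarrow> z * v i = (\<Sum>j<n. of_int (A i j) * v j)"
    and k: "k < n" "v k \<noteq> 0"
  shows "algebraic_int z"
proof -
  define M where "M = mat n n (\<lambda>(i, j). A i j)"
  define M' where "M' = (map_mat of_int M :: 'a mat)"
  have M: "M \<in> carrier_mat n n" "M' \<in> carrier_mat n n"
    by (auto simp: M_def M'_def)
  have "eigenvector M' (vec n v) z"
    unfolding eigenvector_def
  proof (intro conjI)
    show "vec n v \<in> carrier_vec (dim_row M')" using M by auto
    show "vec n v \<noteq> 0\<^sub>v (dim_row M')"
      using k M by (metis carrier_matD(1) index_vec index_zero_vec(1))
    show "M' *\<^sub>v vec n v = z \<cdot>\<^sub>v vec n v"
      by (rule eq_vecI) (auto simp: M'_def M_def A scalar_prod_def atLeast0LessThan)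
  qed
  hence "poly (char_poly M') z = 0"
    using eigenvalue_root_char_poly[OF M(2)] by (auto simp: eigenvalue_def)
  moreover have "char_poly M' = map_poly of_int (char_poly M)"
    unfolding M'_def by (rule of_int_hom.char_poly_hom[OF M(1)])
  ultimately show ?thesis
    using degree_monic_char_poly[OF M(1)] unfolding algebraic_int_altdef_ipoly by auto
qed

text \<open>The field as a module over the integers: \<open>int_module.span B\<close> is the
  additive subgroup generated by \<open>B\<close>.\<close>

interpretation int_module: Modules.module "\<lambda>(n::int) (x::'a::field_char_0). of_int n * x"
  by unfold_locales (auto simp: algebra_simps)

text \<open>This rule would loop together with \<open>of_int_mult\<close> and \<open>mult.assoc\<close>.\<close>

declare int_module.scale_scale [simp del]

text \<open>Expanding each \<open>z * w\<close> in terms of \<open>B\<close> gives an integer matrix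
  that has the vector of the elements of \<open>B\<close> as an eigenvector; this vector is nonzero
  because of \<open>b\<close>.\<close>

lemma algebraic_int_if_stable:
  fixes z :: "'a :: field_char_0"
  assumes B: "finite B" "b \<in> B" "b \<noteq> 0"
    and stable: "\<And>w. w \<in> B \<Longrightarrow> z * w \<in> int_module.span B"
  shows "algebraic_int z"
proof -
  obtain e where e: "bij_betw e {..<card B} B"
    using B(1) ex_bij_betw_nat_finite[of B] by (auto simp: atLeast0LessThan)
  have "\<exists>c. z * w = (\<Sum>b\<in>B. of_int (c b) * b)" if "w \<in> B" for w
    using stable[OF that] B(1) unfolding int_module.span_finite[OF B(1)] by auto
  then obtain c where c: "\<And>w. w \<in> B \<Longrightarrow> z * w = (\<Sum>b\<in>B. of_int (c w b) * b)"
    by metis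
  obtain k where k: "k < card B" "e k = b"
    using e B(2) by (metis bij_betw_imp_surj_on imageE lessThan_iff)
  show ?thesis
  proof (rule algebraic_int_if_eigenvalue[where v = e and k = k and n = "card B" and A = "\<lambda>i j. c (e i) (e j)"])
    fix i assume "i < card B"
    hence "e i \<in> B" using e by (auto simp: bij_betw_def)
    thus "z * e i = (\<Sum>j<card B. of_int (c (e i) (e j)) * e j)"
      using sum.reindex_bij_betw[OF e, of "\<lambda>b. of_int (c (e i) b) * b"] c by simp
  qed (use k B in auto)
qed

lemma int_span_mult:
  assumes "\<And>w. w \<in> B \<Longrightarrow> z * w \<in> int_module.span B" and "w \<in> int_module.span B"
  shows "z * w \<in> int_module.span B"
  using assms(2)
proof (induction rule: int_module.span_induct_alt)
  case (step c x y)
  have "z * (of_int c * x + y) = of_int c * (z * x) + z * y" by (simp add: algebra_simps)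
  thus ?case using step assms(1) by (auto intro!: int_module.span_add int_module.span_scale)
qed (auto intro: int_module.span_zero)

text \<open>The powers of \<open>z\<close> below the \<open>n\<close>-th generate a subgroup that is
  stable under \<open>z\<close>: only the last power leaves the list, and the relation brings it
  back.\<close>

lemma algebraic_int_if_monic_relation:
  fixes z :: "'a :: field_char_0"
  assumes "z ^ n = (\<Sum>i<n. of_int (c i) * z ^ i)"
  shows "algebraic_int z"
proof (rule algebraic_int_if_stable)
  \<comment> \<open>For \<open>n = 0\<close> the relation would read 1 = 0.\<close>
  have "n \<noteq> 0" using assms by (intro notI) simp
  let ?B = "(\<lambda>i. z ^ i) ` {..<n}"
  show "finite ?B" by simp
  show "1 \<in> ?B" using \<open>n \<noteq> 0\<close> by (auto intro!: image_eqI[of _ _ 0])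
  fix w assume "w \<in> ?B"
  then obtain i where i: "i < n" "w = z ^ i" by auto
  show "z * w \<in> int_module.span ?B"
  proof (cases "Suc i < n")
    case True
    thus ?thesis using i by (auto intro!: int_module.span_base image_eqI[of _ _ "Suc i"])
  next
    case False
    hence "z * w = z ^ n" using i by (metis Suc_lessI power_Suc)
    show ?thesis unfolding \<open>z * w = z ^ n\<close> assms
      by (intro int_module.span_sum int_module.span_scale int_module.span_base) auto
  qed
qed simp

lemma monic_relation_if_algebraic_int:
  fixes z :: "'a :: field_char_0"
  assumes "algebraic_int z"
  obtains n c where "n > 0" "z ^ n = (\<Sum>i<n. of_int (c i) * z ^ i)"
proof -
  obtain p :: "int poly" where p: "poly (map_poly of_int p) z = 0" "lead_coeff p = 1"
    using assms by (auto simp: algebraic_int_altdef_ipoly)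
  have "(\<Sum>i\<le>degree p. of_int (coeff p i) * z ^ i) = 0"
    using p(1) by (simp add: poly_altdef degree_map_poly coeff_map_poly)
  moreover have "{..degree p} = insert (degree p) {..<degree p}" by auto
  ultimately have "z ^ degree p + (\<Sum>i<degree p. of_int (coeff p i) * z ^ i) = 0"
    using p(2) by simp
  hence rel: "z ^ degree p = (\<Sum>i<degree p. of_int (- coeff p i) * z ^ i)"
    by (simp add: sum_negf eq_neg_iff_add_eq_0)
  have "degree p \<noteq> 0"
  proof
    assume "degree p = 0"
    from rel[unfolded this] show False by simp
  qed
  thus ?thesis using that[OF _ rel] by simp
qed

text \<open>The relation for \<open>y\<close> may have coefficients that are polynomials in
  \<open>x\<close>. This serves both two independent integers and a \<open>y\<close> that is only
  known to be integral over the ring generated by \<open>x\<close>.\<close>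

lemma common_stable_span:
  fixes x y :: "'a :: field_char_0"
  assumes x: "x ^ n = (\<Sum>i<n. of_int (c i) * x ^ i)" "n > 0"
    and y: "\<And>i. y ^ m * x ^ i \<in> int_module.span {x ^ i * y ^ j | i j. j < m}" "m > 0"
  shows "\<exists>B. finite B \<and> 1 \<in> B \<and> (\<forall>w \<in> int_module.span B. x * w \<in> int_module.span B) \<and>
    (\<forall>w \<in> int_module.span B. y * w \<in> int_module.span B)"
proof (intro exI conjI ballI)
  define B where "B = {x ^ i * y ^ j | i j. i < n \<and> j < m}"
  show fin: "finite B"
    by (rule finite_subset[of _ "(\<lambda>(i, j). x ^ i * y ^ j) ` ({..<n} \<times> {..<m})"]) (auto simp: B_def)
  show "1 \<in> B"
    using x(2) y(2) by (auto simp: B_def intro!: exI[of _ "0::nat"])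
  show stx: "x * w \<in> int_module.span B" if "w \<in> int_module.span B" for w
  proof (rule int_span_mult[OF _ that])
    fix w assume "w \<in> B"
    then obtain i j where ij: "i < n" "j < m" "w = x ^ i * y ^ j" by (auto simp: B_def)
    show "x * w \<in> int_module.span B"
    proof (cases "Suc i < n")
      case True
      have "x * w = x ^ Suc i * y ^ j" using ij by (simp add: mult_ac)
      also have "\<dots> \<in> B" using True ij(2) unfolding B_def by blast
      finally show ?thesis by (rule int_module.span_base)
    next
      case False
      hence "x * w = x ^ n * y ^ j" using ij by (metis Suc_lessI power_Suc mult.assoc)
      also have "\<dots> = (\<Sum>i<n. of_int (c i) * (x ^ i * y ^ j))"
        by (simp add: x(1) sum_distrib_left sum_distrib_right mult_ac)
      also have "\<dots> \<in> int_module.span B"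
        using ij(2) unfolding B_def
        by (intro int_module.span_sum int_module.span_scale int_module.span_base) auto
      finally show ?thesis .
    qed
  qed
  \<comment> \<open>The relation for \<open>y\<close> may involve arbitrary powers of
    \<open>x\<close>; stability under \<open>x\<close> brings all of them back into the span of
    \<open>B\<close>.\<close>
  have pow: "x ^ i * y ^ j \<in> int_module.span B" if "j < m" for i j
  proof (induction i)
    case 0
    have "x ^ 0 * y ^ j \<in> B" using that x(2) unfolding B_def by blast
    thus ?case by (rule int_module.span_base)
  next
    case (Suc i)
    thus ?case using stx by (simp add: mult.assoc)
  qed
  show "y * w \<in> int_module.span B" if "w \<in> int_module.span B" for w
  proof (rule int_span_mult[OF _ that])
    fix w assume "w \<in> B"
    then obtain i j where ij: "i < n" "j < m" "w = x ^ i * y ^ j" by (auto simp: B_def)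
    show "y * w \<in> int_module.span B"
    proof (cases "Suc j < m")
      case True
      have "y * w = x ^ i * y ^ Suc j" using ij by (simp add: mult_ac)
      thus ?thesis using pow[OF True] by metis
    next
      case False
      hence "Suc j = m" using ij by simp
      hence "y * w = y ^ m * x ^ i" using ij by (auto simp: mult_ac)
      also have "\<dots> \<in> int_module.span {x ^ i * y ^ j | i j. j < m}" by (rule y(1))
      also have "\<dots> \<subseteq> int_module.span B"
        by (intro int_module.span_minimal) (auto intro: pow)
      finally show ?thesis .
    qed
  qed
qed

text \<open>A subgroup that is stable under \<open>x\<close> and \<open>y\<close> is stable under
  their sum and product.\<close>

lemma algebraic_int_plus_mult:
  fixes x y :: "'a :: field_char_0"
  assumes "algebraic_int x" "algebraic_int y"
  shows algebraic_int_plus: "algebraic_int (x + y)"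
    and algebraic_int_times: "algebraic_int (x * y)"
proof -
  obtain n c where x: "n > 0" "x ^ n = (\<Sum>i<n. of_int (c i) * x ^ i)"
    using assms(1) by (rule monic_relation_if_algebraic_int)
  obtain m d where y: "m > 0" "y ^ m = (\<Sum>i<m. of_int (d i) * y ^ i)"
    using assms(2) by (rule monic_relation_if_algebraic_int)
  have st: "y ^ m * x ^ i \<in> int_module.span {x ^ i * y ^ j | i j. j < m}" for i
  proof -
    have "y ^ m * x ^ i = (\<Sum>j<m. of_int (d j) * (x ^ i * y ^ j))"
      by (simp add: y(2) sum_distrib_left sum_distrib_right mult_ac)
    also have "\<dots> \<in> int_module.span {x ^ i * y ^ j | i j. j < m}"
      by (intro int_module.span_sum int_module.span_scale int_module.span_base) auto
    finally show ?thesis .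
  qed
  obtain B where B: "finite B" "1 \<in> B"
      "\<forall>w \<in> int_module.span B. x * w \<in> int_module.span B"
      "\<forall>w \<in> int_module.span B. y * w \<in> int_module.span B"
    using common_stable_span[OF x(2,1) st y(1)] by blast
  show "algebraic_int (x + y)" "algebraic_int (x * y)"
    by (rule algebraic_int_if_stable[OF B(1,2)];
        simp add: distrib_right mult.assoc int_module.span_add B(3,4) int_module.span_base)+
qed

text \<open>With \<open>a = z ^ j - z ^ i\<close>, the element \<open>z\<close> is a root of X^j -
  X^i - a, a monic polynomial over the ring generated by the integer \<open>a\<close>.\<close>

lemma algebraic_int_if_power_diff:
  fixes a z :: "'a :: field_char_0"
  assumes "algebraic_int (z ^ j - z ^ i)" "i < j"
  shows "algebraic_int z"
proof -
  define a where "a = z ^ j - z ^ i"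
  obtain n c where a: "n > 0" "a ^ n = (\<Sum>i<n. of_int (c i) * a ^ i)"
    using assms(1) unfolding a_def[symmetric] by (rule monic_relation_if_algebraic_int)
  have "j > 0" using assms(2) by simp
  have st: "z ^ j * a ^ r \<in> int_module.span {a ^ r * z ^ s | r s. s < j}" for r
  proof -
    have "z ^ j * a ^ r = a ^ r * z ^ i + a ^ Suc r * z ^ 0"
      by (simp add: a_def algebra_simps)
    moreover have "a ^ r * z ^ i \<in> {a ^ r * z ^ s | r s. s < j}"
      "a ^ Suc r * z ^ 0 \<in> {a ^ r * z ^ s | r s. s < j}"
      using assms(2) by (blast, intro CollectI exI[of _ "Suc r"] exI[of _ 0]) simp
    ultimately show ?thesis by (simp only: int_module.span_add int_module.span_base)
  qed
  obtain B where B: "finite B" "1 \<in> B"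
      "\<forall>w \<in> int_module.span B. z * w \<in> int_module.span B"
    using common_stable_span[OF a(2,1) st \<open>j > 0\<close>] by blast
  show ?thesis
    by (rule algebraic_int_if_stable[OF B(1,2)]) (simp_all add: B(3) int_module.span_base)
qed

lemma algebraic_int_diff:
  "algebraic_int x \<Longrightarrow> algebraic_int y \<Longrightarrow> algebraic_int (x - y :: 'a :: field_char_0)"
  using algebraic_int_plus[of x "- y"] by simp

lemma algebraic_int_power:
  "algebraic_int x \<Longrightarrow> algebraic_int (x ^ n :: 'a :: field_char_0)"
  by (induction n) (auto intro: algebraic_int_times)

lemma algebraic_int_sum:
  fixes f :: "'i \<Rightarrow> 'a :: field_char_0"
  shows "(\<And>i. i \<in> A \<Longrightarrow> algebraic_int (f i)) \<Longrightarrow> algebraic_int (sum f A)"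
  by (induction A rule: infinite_finite_induct) (auto intro: algebraic_int_plus)

lemmas algebraic_int_intros =
  algebraic_int_plus algebraic_int_times algebraic_int_diff algebraic_int_power
  algebraic_int_minus algebraic_int_of_int algebraic_int_1 algebraic_int_0 algebraic_int_sum


section \<open>Linear dependence and residue classes\<close>

lemma ring_of_type_algebra_simps [simp]:
  "carrier (ring_of_type_algebra :: 'a::ring_1 ring) = UNIV"
  "x \<otimes>\<^bsub>ring_of_type_algebra\<^esub> y = x * y"
  "x \<oplus>\<^bsub>ring_of_type_algebra\<^esub> y = x + y"
  "\<one>\<^bsub>ring_of_type_algebra\<^esub> = (1 :: 'a)"
  "\<zero>\<^bsub>ring_of_type_algebra\<^esub> = (0 :: 'a)"
  by (simp_all add: ring_of_type_algebra_def)

lemma ring_of_type_algebra_a_inv [simp]: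
  "\<ominus>\<^bsub>ring_of_type_algebra\<^esub> x = - (x :: 'a::comm_ring_1)"
proof -
  interpret ring "ring_of_type_algebra :: 'a ring" by (rule ring_from_type_algebra)
  show ?thesis by (rule minus_equality) auto
qed

lemma subfield_ring_of_type_algebraI:
  fixes K :: "'a::field_char_0 set"
  assumes "1 \<in> K" "\<And>x y. x \<in> K \<Longrightarrow> y \<in> K \<Longrightarrow> x - y \<in> K" "\<And>x y. x \<in> K \<Longrightarrow> y \<in> K \<Longrightarrow> x * y \<in> K"
    and "\<And>x. x \<in> K \<Longrightarrow> x \<noteq> 0 \<Longrightarrow> inverse x \<in> K"
  shows "subfield K ring_of_type_algebra"
proof -
  interpret field "ring_of_type_algebra :: 'a ring" by (rule field_from_type_algebra)
  have 0: "0 \<in> K" using assms(1,2) by (metis diff_self)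
  have minus: "- x \<in> K" if "x \<in> K" for x using assms(2)[OF 0 that] by simp
  have plus: "x + y \<in> K" if "x \<in> K" "y \<in> K" for x y
    using assms(2)[OF that(1) minus[OF that(2)]] by simp
  have "inv\<^bsub>ring_of_type_algebra\<^esub> x = inverse x" if "x \<noteq> 0" for x :: 'a
    using that by (intro comm_inv_char) auto
  thus ?thesis
    by (intro subfieldI' subringI) (use assms minus plus in auto)
qed

lemma subfield_Rats: "subfield \<rat> (ring_of_type_algebra :: 'a::field_char_0 ring)"
  by (rule subfield_ring_of_type_algebraI) auto

lemma combine_ring_of_type_algebra:
  fixes Ks Us :: "'a::comm_ring_1 list"
  shows "length Ks = length Us \<Longrightarrow> ring.combine ring_of_type_algebra Ks Us = (\<Sum>i<length Us. Ks ! i * Us ! i)"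
proof (induction Ks Us rule: list_induct2)
  case Nil
  interpret ring "ring_of_type_algebra :: 'a ring" by (rule ring_from_type_algebra)
  show ?case by simp
next
  case (Cons k Ks u Us)
  interpret ring "ring_of_type_algebra :: 'a ring" by (rule ring_from_type_algebra)
  from Cons show ?case by (simp add: sum.lessThan_Suc_shift del: sum.lessThan_Suc)
qed

lemma Rats_common_denominator:
  fixes q :: "'i \<Rightarrow> 'a::field_char_0"
  assumes "finite I" "\<And>i. i \<in> I \<Longrightarrow> q i \<in> \<rat>"
  shows "\<exists>d. d \<noteq> 0 \<and> (\<forall>i\<in>I. of_int d * q i \<in> \<int>)"
  using assms
proof (induction I rule: finite_induct)
  case (insert j I)
  then obtain d where d: "d \<noteq> 0" "\<forall>i\<in>I. of_int d * q i \<in> \<int>" by auto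
  have "q j \<in> \<rat>" using insert.prems by simp
  then obtain a b where ab: "b > 0" "q j = of_int a / of_int b"
    by (rule Rats_cases') blast
  have "of_int (b * d) * q i \<in> \<int>" if "i \<in> insert j I" for i
  proof (cases "i = j")
    case True
    hence "of_int (b * d) * q i = of_int (d * a)" using ab(1) unfolding True ab(2) by simp
    thus ?thesis by (simp only: Ints_of_int)
  next
    case False
    hence "of_int d * q i \<in> \<int>" using d(2) that by blast
    hence "of_int b * (of_int d * q i) \<in> \<int>" by (rule Ints_mult[OF Ints_of_int])
    thus ?thesis by (simp only: of_int_mult mult.assoc)
  qed
  moreover have "b * d \<noteq> 0" using ab(1) d(1) by simp
  ultimately show ?case by blast
qed (auto intro: exI[of _ 1])

text \<open>There is one element more than the dimension over the rationals; a common denominator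
  makes the coefficients of a linear relation integral.\<close>

lemma number_field_dependent:
  fixes x :: "nat \<Rightarrow> 'a::field_char_0"
  assumes "number_field TYPE('a)"
  defines "d \<equiv> field_degree TYPE('a)"
  shows "\<exists>c. (\<exists>i\<le>d. c i \<noteq> 0) \<and> (\<Sum>i\<le>d. of_int (c i) * x i) = 0"
proof -
  interpret ring "ring_of_type_algebra :: 'a ring" by (rule ring_from_type_algebra)
  have dim: "dimension d \<rat> UNIV"
    using finite_dimensionE[OF subfield_Rats] assms
    unfolding number_field_def field_degree_def over_def by simp
  define Us where "Us = map x [0..<Suc d]"
  have len: "length Us = Suc d" by (simp add: Us_def)
  hence "dependent \<rat> Us"
    using independent_length_le_dimension[OF subfield_Rats dim, of Us] by auto
  then obtain Ks where Ks: "length Ks = length Us" "combine Ks Us = 0" "set Ks \<subseteq> \<rat>" "set Ks \<noteq> {0}"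
    using dependent_imp_non_trivial_combine[OF subfield_Rats, of Us] by auto
  have "\<exists>i\<le>d. Ks ! i \<noteq> 0"
  proof (rule ccontr)
    assume "\<not> ?thesis"
    hence "set Ks \<subseteq> {0}" using Ks(1) len by (auto simp: in_set_conv_nth)
    moreover have "Ks \<noteq> []" using Ks(1) len by auto
    ultimately show False using Ks(4) by (cases Ks) auto
  qed
  then obtain i where i: "i \<le> d" "Ks ! i \<noteq> 0" by blast
  have sum: "(\<Sum>i\<le>d. Ks ! i * x i) = 0"
  proof -
    have "0 = (\<Sum>i<Suc d. Ks ! i * Us ! i)"
      using Ks(2) unfolding combine_ring_of_type_algebra[OF Ks(1)] by (simp add: len)
    also have "\<dots> = (\<Sum>i\<le>d. Ks ! i * x i)"
      by (rule sum.cong) (auto simp: Us_def simp del: upt_Suc)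
    finally show ?thesis by simp
  qed
  have rat: "Ks ! i \<in> \<rat>" if "i \<in> {..d}" for i
    using Ks(1,3) len that nth_mem[of i Ks] by auto
  obtain m where m: "m \<noteq> 0" "\<forall>i\<in>{..d}. of_int m * Ks ! i \<in> \<int>"
    using Rats_common_denominator[of "{..d}" "\<lambda>i. Ks ! i", OF finite_atMost rat] by blast
  have "\<exists>n. of_int m * Ks ! i = of_int n" if "i \<le> d" for i
    using m(2) that by (force elim: Ints_cases)
  then obtain c where c: "\<And>i. i \<le> d \<Longrightarrow> of_int m * Ks ! i = of_int (c i)" by metis
  have "(\<Sum>i\<le>d. of_int (c i) * x i) = (\<Sum>i\<le>d. of_int m * Ks ! i * x i)"
    by (rule sum.cong) (simp_all add: c)
  also have "\<dots> = of_int m * (\<Sum>i\<le>d. Ks ! i * x i)" by (simp add: sum_distrib_left mult.assoc)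
  finally have "(\<Sum>i\<le>d. of_int (c i) * x i) = 0" using sum by simp
  moreover have "c i \<noteq> 0" using c[OF i(1)] i(2) m(1) by auto
  ultimately show ?thesis using i(1) by blast
qed

text \<open>As long as \<open>l\<close> divides every coefficient it can be cancelled. This stops
  because the multiplicity of \<open>l\<close> in one fixed nonzero coefficient decreases each
  time.\<close>

lemma number_field_dependent_primitive:
  fixes x :: "nat \<Rightarrow> 'a::field_char_0" and l :: int
  assumes nf: "number_field TYPE('a)" and l: "\<not> is_unit l"
  defines "d \<equiv> field_degree TYPE('a)"
  shows "\<exists>c. (\<exists>i\<le>d. \<not> l dvd c i) \<and> (\<Sum>i\<le>d. of_int (c i) * x i) = 0"
proof (cases "l = 0")
  case True
  thus ?thesis using number_field_dependent[OF nf, of x] unfolding d_def by auto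
next
  case False
  obtain c i where "i \<le> d" "c i \<noteq> 0" "(\<Sum>i\<le>d. of_int (c i) * x i) = 0"
    using number_field_dependent[OF nf, of x] unfolding d_def by blast
  thus ?thesis
  proof (induction "multiplicity l (c i)" arbitrary: c)
    case 0
    hence "\<not> l dvd c i" using l by (simp add: multiplicity_eq_zero_iff)
    thus ?case using 0 by blast
  next
    case (Suc n)
    show ?case
    proof (cases "\<exists>j\<le>d. \<not> l dvd c j")
      case False
      define c' where "c' = (\<lambda>j. c j div l)"
      have c': "c j = l * c' j" if "j \<le> d" for j using False that by (simp add: c'_def)
      have "c' i \<noteq> 0" using c'[OF Suc.prems(1)] Suc.prems(2) by auto
      moreover from this have "n = multiplicity l (c' i)"
        using c'[OF Suc.prems(1)] Suc.hyps(2) l \<open>l \<noteq> 0\<close> by (simp add: multiplicity_times_same)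
      moreover have "of_int l * (\<Sum>i\<le>d. of_int (c' i) * x i) = (\<Sum>i\<le>d. of_int (c i) * x i)"
        unfolding sum_distrib_left by (rule sum.cong) (simp_all add: c')
      hence "(\<Sum>i\<le>d. of_int (c' i) * x i) = 0" using Suc.prems \<open>l \<noteq> 0\<close> by simp
      ultimately show ?thesis using Suc.hyps(1)[of c'] Suc.prems(1) by blast
    qed (use Suc in blast)
  qed
qed

text \<open>If the powers of \<open>x\<close> satisfy an integer relation of degree \<open>n\<close>
  with leading coefficient \<open>m\<close>, multiplication by \<open>m ^ (n - 1)\<close> turns it
  into a monic relation for \<open>m * x\<close>.\<close>

lemma exists_integer_multiple:
  fixes x :: "'a::field_char_0"
  assumes "number_field TYPE('a)"
  obtains m where "m \<noteq> 0" "algebraic_int (of_int m * x)"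
proof -
  define d where "d = field_degree TYPE('a)"
  obtain c i0 where c: "i0 \<le> d" "c i0 \<noteq> 0" "(\<Sum>i\<le>d. of_int (c i) * x ^ i) = 0"
    using number_field_dependent[OF assms, of "\<lambda>i. x ^ i"] unfolding d_def by blast
  \<comment> \<open>The degree of the relation, which may be smaller than \<open>d\<close>.\<close>
  define n where "n = (GREATEST i. i \<le> d \<and> c i \<noteq> 0)"
  have n: "n \<le> d" "c n \<noteq> 0"
    using GreatestI_nat[of "\<lambda>i. i \<le> d \<and> c i \<noteq> 0" i0 d] c unfolding n_def by auto
  have above: "c i = 0" if "i \<le> d" "i > n" for i
    using Greatest_le_nat[of "\<lambda>i. i \<le> d \<and> c i \<noteq> 0" i d] that unfolding n_def by auto
  have "(\<Sum>i\<le>d. of_int (c i) * x ^ i) = (\<Sum>i\<le>n. of_int (c i) * x ^ i)"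
    using n above by (intro sum.mono_neutral_right) auto
  also have "\<dots> = (\<Sum>i<n. of_int (c i) * x ^ i) + of_int (c n) * x ^ n"
    using sum.lessThan_Suc[of "\<lambda>i. of_int (c i) * x ^ i" n] by (simp add: lessThan_Suc_atMost)
  finally have rel: "of_int (c n) * x ^ n = - (\<Sum>i<n. of_int (c i) * x ^ i)"
    using c(3) by (simp add: eq_neg_iff_add_eq_0 add.commute)
  define m where "m = c n"
  have "n > 0"
    using rel n(2) by (intro Nat.gr0I) auto
  have "(of_int m * x) ^ n = of_int (m ^ (n - 1)) * (of_int (c n) * x ^ n)"
    using \<open>n > 0\<close> by (simp add: m_def power_mult_distrib flip: power_Suc2 mult.assoc)
  also have "\<dots> = (\<Sum>i<n. of_int (- c i * m ^ (n - 1 - i)) * (of_int m * x) ^ i)"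
    unfolding rel mult_minus_right sum_distrib_left sum_negf[symmetric]
  proof (intro sum.cong refl)
    fix i assume "i \<in> {..<n}"
    hence "m ^ (n - 1) = m ^ (n - 1 - i) * m ^ i" by (simp flip: power_add)
    thus "- (of_int (m ^ (n - 1)) * (of_int (c i) * x ^ i)) =
        of_int (- c i * m ^ (n - 1 - i)) * (of_int m * x) ^ i"
      by (simp add: power_mult_distrib)
  qed
  finally have "algebraic_int (of_int m * x)"
    by (rule algebraic_int_if_monic_relation)
  thus ?thesis using that n(2) by (simp add: m_def)
qed

section \<open>Finiteness of the ring of integers modulo a positive number\<close>

text \<open>The integers modulo \<open>l\<close> form a vector space over the field with
  \<open>l\<close> elements. Primitive relations bound the size of an independent family by
  \<open>d\<close>, and a maximal one spans, so its combinations with coefficients in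
  \<open>{0..<l}\<close> represent all classes.\<close>

lemma finite_residues_prime:
  fixes l :: int
  assumes nf: "number_field TYPE('a::field_char_0)" and l: "Factorial_Ring.prime l"
  shows "\<exists>F. finite F \<and> (\<forall>f\<in>F. algebraic_int f) \<and>
    (\<forall>a::'a. algebraic_int a \<longrightarrow> (\<exists>f\<in>F. algebraic_int ((a - f) / of_int l)))"
proof -
  define d where "d = field_degree TYPE('a)"
  \<comment> \<open>Linear independence of the classes of \<open>x 0\<close>, ...,
    \<open>x (k - 1)\<close> modulo \<open>l\<close>.\<close>
  define indep where "indep k x \<longleftrightarrow> (\<forall>i<k. algebraic_int (x i)) \<and>
      (\<forall>c. algebraic_int ((\<Sum>i<k. of_int (c i) * x i) / of_int l) \<longrightarrow> (\<forall>i<k. l dvd c i))"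
    for k and x :: "nat \<Rightarrow> 'a"
  have l0: "l > 0" "of_int l \<noteq> (0::'a)" "\<not> is_unit l" using l by (auto simp: prime_gt_0_int)
  have bound: "k \<le> d" if "indep k x" for k x
  proof (rule ccontr)
    assume "\<not> k \<le> d"
    obtain c i where c: "i \<le> d" "\<not> l dvd c i" "(\<Sum>i\<le>d. of_int (c i) * x i) = 0"
      using number_field_dependent_primitive[OF nf l0(3), of x] unfolding d_def by blast
    define c' where "c' = (\<lambda>i. if i \<le> d then c i else 0)"
    have "(\<Sum>i<k. of_int (c' i) * x i) = (\<Sum>i\<le>d. of_int (c' i) * x i)"
      using \<open>\<not> k \<le> d\<close> by (intro sum.mono_neutral_right) (auto simp: c'_def)
    also have "\<dots> = 0" using c(3) by (simp add: c'_def)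
    finally have "l dvd c' i" using that c(1) \<open>\<not> k \<le> d\<close> unfolding indep_def by auto
    thus False using c by (simp add: c'_def)
  qed
  have "indep 0 x" for x by (simp add: indep_def)
  define k where "k = (GREATEST k. \<exists>x. indep k x)"
  have "\<exists>x. indep k x"
    unfolding k_def by (rule GreatestI_nat[of _ 0 d]) (use bound \<open>indep 0 _\<close> in blast)+
  then obtain x where x: "indep k x" by blast
  have max: "\<not> indep (Suc k) y" for y
    using Greatest_le_nat[of "\<lambda>k. \<exists>x. indep k x" "Suc k" d] bound unfolding k_def by force
  define F where "F = (\<lambda>c. \<Sum>i<k. of_int (c i) * x i) ` ({..<k} \<rightarrow>\<^sub>E {0..<l})"
  show ?thesis
  proof (intro exI[of _ F] conjI ballI allI impI)
    show "finite F" unfolding F_def by (intro finite_imageI finite_PiE) auto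
    show "algebraic_int f" if "f \<in> F" for f
      using that x unfolding F_def indep_def by (auto intro!: algebraic_int_intros)
    fix a :: 'a assume a: "algebraic_int a"
    define y where "y = x(k := a)"
    have "\<forall>i<Suc k. algebraic_int (y i)" using a x by (auto simp: y_def indep_def less_Suc_eq)
    with max[of y] obtain c i where c: "algebraic_int ((\<Sum>i<Suc k. of_int (c i) * y i) / of_int l)"
      "i < Suc k" "\<not> l dvd c i"
      unfolding indep_def by blast
    have sum: "(\<Sum>i<Suc k. of_int (c i) * y i) = (\<Sum>i<k. of_int (c i) * x i) + of_int (c k) * a"
      by (simp add: y_def)
    \<comment> \<open>Otherwise the term with \<open>a\<close> drops out modulo \<open>l\<close>,
      which leaves a nontrivial relation between the independent \<open>x i\<close>.\<close>
    have "\<not> l dvd c k"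
    proof
      assume "l dvd c k"
      then obtain e where e: "c k = l * e" by blast
      have "(\<Sum>i<k. of_int (c i) * x i) / of_int l =
          (\<Sum>i<Suc k. of_int (c i) * y i) / of_int l - of_int e * a"
        unfolding sum e using l0(2) by (simp add: add_divide_distrib mult.assoc)
      hence "algebraic_int ((\<Sum>i<k. of_int (c i) * x i) / of_int l)"
        using c(1) a by (auto intro!: algebraic_int_intros)
      hence "\<forall>i<k. l dvd c i" using x unfolding indep_def by blast
      thus False using c(2,3) \<open>l dvd c k\<close> by (auto simp: less_Suc_eq)
    qed
    hence "Rings.coprime (c k) l" using l by (meson coprime_commute prime_imp_coprime)
    then obtain u v where uv: "u * c k + v * l = 1"
      using bezout_int[of "c k" l] by auto
    \<comment> \<open>Since \<open>u\<close> inverts \<open>c k\<close> modulo \<open>l\<close>,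
      solving the relation for \<open>a\<close> gives the coefficients \<open>- u * c i\<close>.
      Their remainders \<open>e\<close> yield the representative, and the quotients \<open>g\<close>
      go into the multiple of \<open>l\<close>.\<close>
    define e where "e = (\<lambda>i. (- u * c i) mod l)"
    define g where "g = (\<lambda>i. (- u * c i) div l)"
    have eg: "of_int (- u * c i) = of_int (e i) + of_int (g i) * (of_int l :: 'a)" for i
      unfolding e_def g_def by (simp flip: of_int_mult of_int_add)
    define f where "f = (\<Sum>i<k. of_int (e i) * x i)"
    have "f = (\<Sum>i<k. of_int (restrict e {..<k} i) * x i)" unfolding f_def by (rule sum.cong) auto
    moreover have "restrict e {..<k} \<in> {..<k} \<rightarrow>\<^sub>E {0..<l}"
      using l0(1) by (auto simp: e_def)
    ultimately have "f \<in> F" unfolding F_def by blast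
    have "a - f = of_int u * (\<Sum>i<Suc k. of_int (c i) * y i) + of_int (v * l) * a +
        of_int l * (\<Sum>i<k. of_int (g i) * x i)"
    proof -
      have "a - f = of_int (u * c k + v * l) * a - f" using uv by simp
      moreover have "f = - of_int u * (\<Sum>i<k. of_int (c i) * x i) - of_int l * (\<Sum>i<k. of_int (g i) * x i)"
      proof -
        have "f = (\<Sum>i<k. (of_int (- u * c i) - of_int (g i) * of_int l) * x i)"
          unfolding f_def eg by simp
        thus ?thesis by (simp add: sum_distrib_left sum_subtractf algebra_simps)
      qed
      ultimately show ?thesis unfolding sum by (simp add: ring_distribs mult_ac)
    qed
    hence "(a - f) / of_int l = of_int u * ((\<Sum>i<Suc k. of_int (c i) * y i) / of_int l) + of_int v * a +
        (\<Sum>i<k. of_int (g i) * x i)"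
      using l0(2) by (simp add: field_simps del: sum.lessThan_Suc)
    also have "algebraic_int \<dots>"
      using c(1) a x unfolding indep_def
      by (intro algebraic_int_plus algebraic_int_times algebraic_int_sum) (auto simp del: sum.lessThan_Suc)
    finally show "\<exists>f\<in>F. algebraic_int ((a - f) / of_int l)" using \<open>f \<in> F\<close> by blast
  qed
qed

text \<open>Induction over the prime factors: if \<open>a = f + m * b\<close>, then reducing
  \<open>b\<close> modulo \<open>l\<close> to \<open>g\<close> gives the representative
  \<open>f + m * g\<close> modulo \<open>l * m\<close>.\<close>

lemma finite_residues:
  assumes nf: "number_field TYPE('a::field_char_0)" and "m > 0"
  shows "\<exists>F. finite F \<and> (\<forall>f\<in>F. algebraic_int f) \<and>
    (\<forall>a::'a. algebraic_int a \<longrightarrow> (\<exists>f\<in>F. algebraic_int ((a - f) / of_nat m)))"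
  using assms(2)
proof (induction m rule: prime_divisors_induct)
  case (unit m)
  hence "m = 1" by simp
  thus ?case by (intro exI[of _ "{0}"]) auto
next
  case (factor l m)
  hence "m > 0" by (auto intro: Nat.gr0I)
  with factor obtain F where F: "finite F" "\<forall>f\<in>F. algebraic_int f"
      "\<And>a::'a. algebraic_int a \<Longrightarrow> \<exists>f\<in>F. algebraic_int ((a - f) / of_nat m)" by blast
  have "Factorial_Ring.prime (int l)" using factor by simp
  from finite_residues_prime[OF nf this] obtain G where G: "finite G" "\<forall>f\<in>G. algebraic_int f"
      "\<And>a::'a. algebraic_int a \<Longrightarrow> \<exists>f\<in>G. algebraic_int ((a - f) / of_nat l)" by auto
  show ?case
  proof (intro exI[of _ "(\<lambda>(f, g). f + of_nat m * g) ` (F \<times> G)"] conjI ballI allI impI)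
    show "finite ((\<lambda>(f, g). f + of_nat m * g) ` (F \<times> G))" using F G by auto
    show "algebraic_int h" if "h \<in> (\<lambda>(f, g). f + of_nat m * g) ` (F \<times> G)" for h
      using that F G by (auto intro!: algebraic_int_intros)
    fix a :: 'a assume "algebraic_int a"
    then obtain f where f: "f \<in> F" "algebraic_int ((a - f) / of_nat m)" using F by blast
    from G(3)[OF f(2)] obtain g where g: "g \<in> G" "algebraic_int (((a - f) / of_nat m - g) / of_nat l)"
      by blast
    have "((a - f) / of_nat m - g) / of_nat l = (a - (f + of_nat m * g)) / of_nat (l * m)"
      using \<open>m > 0\<close> by (simp add: field_simps)
    thus "\<exists>f\<in>(\<lambda>(f, g). f + of_nat m * g) ` (F \<times> G). algebraic_int ((a - f) / of_nat (l * m))"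
      using f g by (intro bexI[of _ "f + of_nat m * g"]) auto
  qed
qed auto

lemma pigeonhole_residues:
  fixes s :: "nat \<Rightarrow> 'a::field_char_0"
  assumes nf: "number_field TYPE('a)" and "m > 0" "\<And>k. algebraic_int (s k)"
  obtains i j where "i < j" "algebraic_int ((s j - s i) / of_nat m)"
proof -
  obtain F where F: "finite F" "\<And>a::'a. algebraic_int a \<Longrightarrow> \<exists>f\<in>F. algebraic_int ((a - f) / of_nat m)"
    using finite_residues[OF nf assms(2)] by blast
  have "\<forall>k. \<exists>f. f \<in> F \<and> algebraic_int ((s k - f) / of_nat m)"
    using F(2)[OF assms(3)] by blast
  then obtain r where r: "\<And>k. r k \<in> F" "\<And>k. algebraic_int ((s k - r k) / of_nat m)"
    using choice[of "\<lambda>k f. f \<in> F \<and> algebraic_int ((s k - f) / of_nat m)"] by blast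
  have "\<not> inj r" using F(1) r(1) by (meson finite_subset image_subsetI infinite_UNIV_nat finite_imageD)
  then obtain i j where "i \<noteq> j" "r i = r j" unfolding inj_def by blast
  hence "\<exists>i j. i < j \<and> r i = r j" by (metis linorder_neqE_nat)
  then obtain i j where ij: "i < j" "r i = r j" by blast
  have "(s j - s i) / of_nat m = (s j - r j) / of_nat m - (s i - r i) / of_nat m"
    using ij(2) by (simp add: diff_divide_distrib)
  also have "algebraic_int \<dots>" by (rule algebraic_int_diff[OF r(2) r(2)])
  finally show ?thesis by (rule that[OF ij(1)])
qed

text \<open>Two of the integers \<open>m z\<^sup>k\<close> are congruent modulo \<open>m\<close>, so some \<open>z\<^sup>j - z\<^sup>i\<close> is an integer.\<close>

lemma algebraic_int_if_almost_integral:
  fixes z :: "'a::field_char_0"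
  assumes nf: "number_field TYPE('a)" and "m > 0" "\<And>k. algebraic_int (of_nat m * z ^ k)"
  shows "algebraic_int z"
proof -
  obtain i j where ij: "i < j" "algebraic_int ((of_nat m * z ^ j - of_nat m * z ^ i) / of_nat m)"
    by (rule pigeonhole_residues[of m "\<lambda>k. of_nat m * z ^ k", OF assms])
  moreover have "(of_nat m * z ^ j - of_nat m * z ^ i) / of_nat m = z ^ j - z ^ i"
    using assms(2) by (simp add: diff_divide_distrib)
  ultimately show ?thesis by (intro algebraic_int_if_power_diff[of z j i]) auto
qed


section \<open>Primes of the ring of integers\<close>

lemma ring_of_integers_simps [simp]:
  "carrier (ring_of_integers :: 'a::field_char_0 ring) = {x. algebraic_int x}"
  "x \<otimes>\<^bsub>ring_of_integers\<^esub> y = (x * y :: 'a)"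
  "x \<oplus>\<^bsub>ring_of_integers\<^esub> y = (x + y :: 'a)"
  "\<one>\<^bsub>ring_of_integers\<^esub> = (1 :: 'a)"
  "\<zero>\<^bsub>ring_of_integers\<^esub> = (0 :: 'a)"
  by (simp_all add: ring_of_integers_def ring_of_type_algebra_def)

lemma exists_integer_denominator:
  fixes x :: "'a::field_char_0"
  assumes "number_field TYPE('a)"
  obtains m where "m > 0" "algebraic_int (of_nat m * x)"
proof -
  obtain k where k: "k \<noteq> 0" "algebraic_int (of_int k * x)"
    by (rule exists_integer_multiple[OF assms])
  have "of_nat (nat \<bar>k\<bar>) * x = of_int k * x \<or> of_nat (nat \<bar>k\<bar>) * x = - (of_int k * x)"
    by (cases "k \<ge> 0") auto
  hence "algebraic_int (of_nat (nat \<bar>k\<bar>) * x)" using k(2) algebraic_int_minus by metis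
  thus ?thesis using that[of "nat \<bar>k\<bar>"] k(1) by simp
qed

locale number_field_prime =
  fixes p :: "'a::field_char_0 set"
  assumes nf: "number_field TYPE('a)" and p: "p \<in> finite_primes"
begin

lemma primeideal: "primeideal p ring_of_integers"
  using p by (simp add: finite_primes_def)

sublocale prime: primeideal p ring_of_integers
  by (rule primeideal)

lemma integral: "x \<in> p \<Longrightarrow> algebraic_int x"
  using prime.Icarr by auto

lemma zero_mem: "0 \<in> p"
  using additive_subgroup.zero_closed[OF prime.is_additive_subgroup] by simp

lemma add_mem: "x \<in> p \<Longrightarrow> y \<in> p \<Longrightarrow> x + y \<in> p"
  using additive_subgroup.a_closed[OF prime.is_additive_subgroup] by simp

lemma mult_mem: "x \<in> p \<Longrightarrow> algebraic_int y \<Longrightarrow> y * x \<in> p"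
  using prime.I_l_closed by simp

lemma diff_mem: "x \<in> p \<Longrightarrow> y \<in> p \<Longrightarrow> x - y \<in> p"
  using add_mem[of x "- 1 * y"] mult_mem[of y "- 1"] by simp

lemma prime_mem: "algebraic_int x \<Longrightarrow> algebraic_int y \<Longrightarrow> x * y \<in> p \<Longrightarrow> x \<in> p \<or> y \<in> p"
  using prime.I_prime by simp

lemma one_not_mem: "1 \<notin> p"
  using mult_mem[of 1] prime.I_notcarr integral by auto

lemma power_mem: "algebraic_int x \<Longrightarrow> x ^ n \<in> p \<Longrightarrow> x \<in> p"
proof (induction n)
  case 0
  thus ?case using one_not_mem by simp
next
  case (Suc n)
  thus ?case using prime_mem[of x "x ^ n"] by (auto intro: algebraic_int_power)
qed

text \<open>If \<open>m\<close> is a denominator of the inverse of a nonzero \<open>x\<close> in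
  \<open>p\<close>, then \<open>m\<close> is an integral multiple of \<open>x\<close>.\<close>

lemma exists_nat_mem:
  obtains m where "m > 0" "of_nat m \<in> p"
proof -
  obtain x where x: "x \<in> p" "x \<noteq> 0"
    using p zero_mem by (auto simp: finite_primes_def)
  obtain m where m: "m > 0" "algebraic_int (of_nat m * inverse x)"
    by (rule exists_integer_denominator[OF nf, of "inverse x"])
  have "of_nat m * inverse x * x \<in> p" by (rule mult_mem[OF x(1) m(2)])
  moreover have "of_nat m * inverse x * x = of_nat m" using x(2) by (simp add: mult.assoc)
  ultimately have "of_nat m \<in> p" by simp
  with m(1) show ?thesis by (rule that)
qed

text \<open>Two powers of \<open>x\<close> agree modulo \<open>p\<close>. As \<open>p\<close> is
  prime, the smaller one can be cancelled, so some positive power of \<open>x\<close> is 1 modulo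
  \<open>p\<close>, and the preceding power is the inverse.\<close>

lemma inverse_mod:
  assumes x: "algebraic_int x" "x \<notin> p"
  obtains s where "algebraic_int s" "1 - x * s \<in> p"
proof -
  obtain m where m: "m > 0" "of_nat m \<in> p" by (rule exists_nat_mem)
  obtain i j where ij: "i < j" "algebraic_int ((x ^ j - x ^ i) / of_nat m)"
    by (rule pigeonhole_residues[where s = "\<lambda>k. x ^ k", OF nf m(1) algebraic_int_power[OF x(1)]])
  have "(x ^ j - x ^ i) / of_nat m * of_nat m \<in> p" by (rule mult_mem[OF m(2) ij(2)])
  hence "x ^ j - x ^ i \<in> p" using m(1) by simp
  hence "- 1 * (x ^ j - x ^ i) \<in> p" by (rule mult_mem) auto
  moreover have "x ^ j = x ^ i * x ^ (j - i)" using ij(1) by (simp flip: power_add)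
  hence "- 1 * (x ^ j - x ^ i) = x ^ i * (1 - x ^ (j - i))" by (simp add: algebra_simps)
  ultimately have "x ^ i \<in> p \<or> 1 - x ^ (j - i) \<in> p"
    using x by (intro prime_mem) (auto intro: algebraic_int_intros)
  hence "1 - x ^ (j - i) \<in> p" using power_mem x by blast
  moreover have "x ^ (j - i) = x * x ^ (j - i - 1)" using ij(1) by (simp add: power_eq_if)
  ultimately have "1 - x * x ^ (j - i - 1) \<in> p" by simp
  thus ?thesis by (rule that[OF algebraic_int_power[OF x(1)]])
qed

text \<open>
  The maximal ideal \<open>p\<close> is the annihilator of a class \<open>y\<close> in the finite ring of integers modulo
  \<open>m\<close>: among the annihilators of classes that are contained in \<open>p\<close>, a maximal one equals \<open>p\<close>.
\<close>

lemma exists_annihilated: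
  assumes m: "m > 0" "of_nat m \<in> p"
  shows "\<exists>y. algebraic_int y \<and> \<not> algebraic_int (y / of_nat m) \<and>
    (\<forall>z\<in>p. algebraic_int (z * (y / of_nat m)))"
proof -
  obtain F where F: "finite F" "\<And>a::'a. algebraic_int a \<Longrightarrow> \<exists>f\<in>F. algebraic_int ((a - f) / of_nat m)"
      "\<And>f. f \<in> F \<Longrightarrow> algebraic_int f"
    using finite_residues[OF nf m(1)] by blast
  \<comment> \<open>The annihilator of the class of \<open>y\<close> in the ring of integers modulo
    \<open>m\<close>.\<close>
  define Ann where "Ann y = {z. algebraic_int z \<and> algebraic_int (z * (y / of_nat m))}" for y :: 'a
  define ok where "ok y \<longleftrightarrow> algebraic_int y \<and> Ann y \<subseteq> p" for y
  have m0: "(of_nat m :: 'a) \<noteq> 0" using m(1) by simp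
  have Ann_int: "algebraic_int z" "algebraic_int (z * (y / of_nat m))" if "z \<in> Ann y" for z y
    using that unfolding Ann_def by blast+
  have AnnI: "z \<in> Ann y" if "algebraic_int z" "algebraic_int (z * (y / of_nat m))" for z y
    using that unfolding Ann_def by blast
  have Ann_swap: "z * s \<in> Ann y \<longleftrightarrow> z \<in> Ann (s * y)" if "algebraic_int s" "algebraic_int z" for s z y
  proof -
    have "z * s * (y / of_nat m) = z * (s * y / of_nat m)" by simp
    thus ?thesis using algebraic_int_times[OF that(2,1)] that(2) unfolding Ann_def mem_Collect_eq by metis
  qed
  have Ann_mult: "Ann y \<subseteq> Ann (s * y)" if s: "algebraic_int s" for s y
  proof
    fix z assume z: "z \<in> Ann y"
    have "s * (z * (y / of_nat m)) = z * (s * y / of_nat m)" by simp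
    with algebraic_int_times[OF s Ann_int(2)[OF z]] show "z \<in> Ann (s * y)"
      by (intro AnnI Ann_int(1)[OF z]) (simp only:)
  qed
  have "z \<in> p" if "z \<in> Ann 1" for z
    using mult_mem[OF m(2) Ann_int(2)[OF that]] m0 by simp
  hence "ok 1" unfolding ok_def by auto
  \<comment> \<open>An annihilator is a union of classes modulo \<open>m\<close>, so its size can be
    measured by the representatives in \<open>F\<close> that it contains.\<close>
  moreover have "\<forall>y. ok y \<longrightarrow> card (Ann y \<inter> F) < Suc (card F)"
    using F(1) by (auto intro!: card_mono simp: less_Suc_eq_le)
  ultimately obtain y where y: "ok y" and max: "\<And>y'. ok y' \<Longrightarrow> card (Ann y' \<inter> F) \<le> card (Ann y \<inter> F)"
    using ex_has_greatest_nat[of ok 1 "\<lambda>y. card (Ann y \<inter> F)"] by blast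
  have y_int: "algebraic_int y" and y_sub: "Ann y \<subseteq> p" using y by (simp_all add: ok_def)
  have maximal: "Ann y' \<subseteq> Ann y" if "ok y'" "Ann y \<subseteq> Ann y'" for y'
  proof
    fix z assume z: "z \<in> Ann y'"
    obtain f where f: "f \<in> F" "algebraic_int ((z - f) / of_nat m)" using F(2) Ann_int(1)[OF z] by blast
    define w where "w = (z - f) / of_nat m"
    have w: "algebraic_int w" using f(2) by (simp add: w_def)
    \<comment> \<open>For integral \<open>u\<close>, the products of \<open>z\<close> and of its
      representative \<open>f\<close> with \<open>u / m\<close> differ by an integer. So membership
      in an annihilator can be tested on \<open>f\<close>.\<close>
    have shift: "z * (u / of_nat m) = f * (u / of_nat m) + w * u" for u
    proof -
      have "z = f + w * of_nat m" using m0 by (simp add: w_def)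
      thus ?thesis using m0 by (simp add: add_divide_distrib distrib_right)
    qed
    have y': "algebraic_int y'" using that(1) by (simp add: ok_def)
    have "algebraic_int (z * (y' / of_nat m) - w * y')"
      by (rule algebraic_int_diff[OF Ann_int(2)[OF z] algebraic_int_times[OF w y']])
    hence "algebraic_int (f * (y' / of_nat m))" by (simp only: shift add_diff_cancel_right')
    hence "f \<in> Ann y' \<inter> F" using AnnI f(1) F(3) by blast
    moreover have "Ann y \<inter> F = Ann y' \<inter> F"
      using that max[OF that(1)] F(1) by (intro card_seteq) auto
    ultimately have "algebraic_int (f * (y / of_nat m))" using Ann_int(2) by blast
    hence "algebraic_int (z * (y / of_nat m))"
      unfolding shift by (rule algebraic_int_plus[OF _ algebraic_int_times[OF w y_int]])
    thus "z \<in> Ann y" by (rule AnnI[OF Ann_int(1)[OF z]])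
  qed
  have "x \<in> Ann y" if x: "x \<in> p" for x
  proof (cases "ok (x * y)")
    case True
    \<comment> \<open>This case is contradictory. By maximality, passing from \<open>y\<close> to
      \<open>x * y\<close> does not enlarge the annihilator, and neither does any power of
      \<open>x\<close>. Two powers of \<open>x\<close> agree modulo \<open>m\<close>, so some
      \<open>1 - x ^ (j - i)\<close> annihilates \<open>x ^ i * y\<close> and therefore lies in
      \<open>p\<close>; together with \<open>x\<close> this puts 1 into \<open>p\<close>.\<close>
    note x_int = integral[OF x]
    have sub: "Ann (x * y) \<subseteq> Ann y" by (rule maximal[OF True Ann_mult[OF x_int]])
    have pow: "Ann (x ^ k * y) \<subseteq> Ann y" for k
    proof (induction k)
      case (Suc k)
      show ?case
      proof
        fix z assume z: "z \<in> Ann (x ^ Suc k * y)"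
        note z_int = Ann_int(1)[OF z]
        have "x ^ Suc k * y = x ^ k * (x * y)" by simp
        hence "z * x ^ k \<in> Ann (x * y)"
          using Ann_swap[OF algebraic_int_power[OF x_int] z_int] z by metis
        hence "z * x ^ k \<in> Ann y" using sub by blast
        hence "z \<in> Ann (x ^ k * y)" using Ann_swap[OF algebraic_int_power[OF x_int] z_int] by metis
        thus "z \<in> Ann y" using Suc by blast
      qed
    qed simp
    obtain i j where ij: "i < j" "algebraic_int ((x ^ j - x ^ i) / of_nat m)"
      by (rule pigeonhole_residues[where s = "\<lambda>k. x ^ k", OF nf m(1) algebraic_int_power[OF x_int]])
    have "algebraic_int ((x ^ j - x ^ i) / of_nat m * (- y))"
      by (intro algebraic_int_times ij algebraic_int_minus y_int)
    moreover have "x ^ j = x ^ i * x ^ (j - i)" using ij(1) by (simp flip: power_add)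
    hence "(x ^ j - x ^ i) / of_nat m * (- y) = (1 - x ^ (j - i)) * (x ^ i * y / of_nat m)"
      by (simp add: algebra_simps diff_divide_distrib)
    ultimately have "1 - x ^ (j - i) \<in> Ann (x ^ i * y)"
      using AnnI[OF algebraic_int_diff[OF algebraic_int_1 algebraic_int_power[OF x_int]]] by metis
    hence "1 - x ^ (j - i) \<in> p" using pow y_sub by blast
    moreover have "x ^ (j - i - 1) * x \<in> p" by (rule mult_mem[OF x algebraic_int_power[OF x_int]])
    hence "x ^ (j - i) \<in> p" using ij(1) by (metis power_minus_mult zero_less_diff)
    ultimately have "1 - x ^ (j - i) + x ^ (j - i) \<in> p" by (rule add_mem)
    thus ?thesis using one_not_mem by simp
  next
    case False
    have "algebraic_int (x * y)" by (intro algebraic_int_times integral[OF x] y_int)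
    \<comment> \<open>Some \<open>s\<close> outside \<open>p\<close> annihilates
      \<open>x * y\<close>. By primality \<open>s * y\<close> is again admissible, so by maximality
      it has the same annihilator as \<open>y\<close>, and this contains \<open>x\<close>.\<close>
    with False obtain s where s: "s \<notin> p" "s \<in> Ann (x * y)" by (auto simp: ok_def)
    note s_int = Ann_int(1)[OF s(2)]
    have "Ann (s * y) \<subseteq> p"
    proof
      fix z assume z: "z \<in> Ann (s * y)"
      hence "z * s \<in> Ann y" using Ann_swap[OF s_int Ann_int(1)[OF z]] by blast
      hence "z * s \<in> p" using y_sub by blast
      thus "z \<in> p" using prime_mem[OF Ann_int(1)[OF z] s_int] s(1) by blast
    qed
    hence "ok (s * y)" using algebraic_int_times[OF s_int y_int] by (simp add: ok_def)
    hence "Ann (s * y) \<subseteq> Ann y" by (rule maximal[OF _ Ann_mult[OF s_int]])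
    moreover have "s * (x * y / of_nat m) = x * (s * y / of_nat m)" by simp
    hence "x \<in> Ann (s * y)" using AnnI[OF integral[OF x]] Ann_int(2)[OF s(2)] by metis
    ultimately show ?thesis by blast
  qed
  moreover have "\<not> algebraic_int (y / of_nat m)"
  proof
    assume "algebraic_int (y / of_nat m)"
    hence "1 \<in> Ann y" by (intro AnnI) auto
    thus False using y_sub one_not_mem by blast
  qed
  ultimately show ?thesis using Ann_int(2) y_int by blast
qed

text \<open>Take \<open>g = y / m\<close> with \<open>y\<close> the annihilated class. If
  \<open>g\<close> mapped \<open>p\<close> into itself, then all \<open>m * g ^ k\<close> would lie
  in \<open>p\<close>, so that \<open>g\<close> would be almost integral and hence integral,
  contrary to the choice of \<open>y\<close>.\<close>

lemma exists_inverse_generator: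
  shows "\<exists>g. \<exists>\<pi>\<in>p. g * \<pi> \<notin> p \<and> (\<forall>a\<in>p. algebraic_int (g * a))"
proof -
  obtain m where m: "m > 0" "of_nat m \<in> p" by (rule exists_nat_mem)
  obtain y where y: "algebraic_int y" "\<not> algebraic_int (y / of_nat m)"
    "\<forall>z\<in>p. algebraic_int (z * (y / of_nat m))"
    using exists_annihilated[OF m] by blast
  define g where "g = y / of_nat m"
  have g: "algebraic_int (g * a)" if "a \<in> p" for a
    using y(3) that by (simp add: g_def mult.commute)
  have "\<exists>\<pi>\<in>p. g * \<pi> \<notin> p"
  proof (rule ccontr)
    assume "\<not> ?thesis"
    hence stable: "g * a \<in> p" if "a \<in> p" for a using that by blast
    have "of_nat m * g ^ k \<in> p" for k
    proof (induction k)
      case (Suc k)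
      have "g * (of_nat m * g ^ k) \<in> p" by (rule stable[OF Suc])
      thus ?case by (simp add: mult_ac)
    qed (use m in simp)
    hence "algebraic_int (of_nat m * g ^ k)" for k by (rule integral)
    hence "algebraic_int g" by (rule algebraic_int_if_almost_integral[OF nf m(1)])
    thus False using y(2) by (simp add: g_def)
  qed
  thus ?thesis using g by blast
qed

section \<open>Powers of a prime and the order of an element\<close>

abbreviation pow :: "nat \<Rightarrow> 'a set" where
  "pow n \<equiv> p [^]\<^bsub>ideals_set ring_of_integers\<^esub> n"

sublocale ideals: semiring "ideals_set (ring_of_integers :: 'a ring)"
  by (rule prime.ideals_set_is_semiring)

lemma p_mem_ideals: "p \<in> carrier (ideals_set ring_of_integers)"
  using prime.is_ideal by (simp add: ideals_set_def)

lemma pow_ideal: "ideal (pow n) ring_of_integers"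
  using ideals.nat_pow_closed[OF p_mem_ideals] by (simp add: ideals_set_def)

lemma pow_0: "pow 0 = {x. algebraic_int x}"
  using ideals.nat_pow_0 by (simp add: ideals_set_def)

lemma pow_Suc: "pow (Suc n) = ideal_prod ring_of_integers (pow n) p"
  using ideals.nat_pow_Suc by (simp add: ideals_set_def)

lemma pow_1: "pow 1 = p"
  using ideals.nat_pow_eone[OF p_mem_ideals] by simp

lemma pow_integral: "x \<in> pow n \<Longrightarrow> algebraic_int x"
  using ideal.Icarr[OF pow_ideal] by auto

lemma pow_mult: "x \<in> pow n \<Longrightarrow> algebraic_int y \<Longrightarrow> y * x \<in> pow n"
  using ideal.I_l_closed[OF pow_ideal] by auto

lemma pow_add: "x \<in> pow n \<Longrightarrow> y \<in> pow n \<Longrightarrow> x + y \<in> pow n"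
  using additive_subgroup.a_closed[OF ideal.axioms(1)[OF pow_ideal]] by auto

lemma power_mem_pow: "x \<in> p \<Longrightarrow> x ^ n \<in> pow n"
proof (induction n)
  case (Suc n)
  thus ?case
    unfolding pow_Suc using ideal_prod.prod[of "x ^ n" "pow n" x p ring_of_integers]
    by (simp add: mult.commute)
next
  case 0
  show ?case unfolding pow_0 by simp
qed

text \<open>An element outside \<open>p\<close> is invertible modulo every power of
  \<open>p\<close>: if \<open>t\<close> inverts \<open>s\<close> modulo \<open>p\<close>, then
  \<open>(1 - s * t) ^ n\<close> lies in \<open>pow n\<close> and has the form
  \<open>1 - w * s\<close>.\<close>

lemma pow_cancel:
  assumes "algebraic_int s" "s \<notin> p" "algebraic_int a" "s * a \<in> pow n"
  shows "a \<in> pow n"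
proof -
  obtain t where t: "algebraic_int t" "1 - s * t \<in> p" by (rule inverse_mod[OF assms(1,2)])
  have "\<exists>w. algebraic_int w \<and> (1 - s * t) ^ n = 1 - w * s"
  proof (induction n)
    case (Suc n)
    then obtain w where w: "algebraic_int w" "(1 - s * t) ^ n = 1 - w * s" by blast
    have "(1 - s * t) ^ Suc n = 1 - (t + w - w * s * t) * s"
      by (simp add: w(2) algebra_simps)
    moreover have "algebraic_int (t + w - w * s * t)"
      by (intro algebraic_int_diff algebraic_int_plus algebraic_int_times w(1) t(1) assms(1))
    ultimately show ?case by blast
  qed (auto intro: exI[of _ 0])
  then obtain w where w: "algebraic_int w" "(1 - s * t) ^ n = 1 - w * s" by blast
  have "a * (1 - w * s) \<in> pow n"
    using pow_mult[OF power_mem_pow[OF t(2)] assms(3), of n] by (simp add: w)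
  moreover have "w * (s * a) \<in> pow n" by (rule pow_mult[OF assms(4) w(1)])
  ultimately have "a * (1 - w * s) + w * (s * a) \<in> pow n" by (rule pow_add)
  thus ?thesis by (simp add: algebra_simps)
qed

text \<open>Both facts rest on the same \<open>g\<close>: the order of \<open>a\<close> is the
  exponent \<open>n\<close> for which \<open>g ^ n * a\<close> is an integer outside
  \<open>p\<close>. Such integers are closed under multiplication, which makes the order
  additive.\<close>

lemma ord_integer_facts:
  shows mem_pow_iff: "algebraic_int a \<Longrightarrow> a \<noteq> 0 \<Longrightarrow> a \<in> pow n \<longleftrightarrow> n \<le> ord_integer p a"
    and ord_integer_mult: "algebraic_int a \<Longrightarrow> algebraic_int b \<Longrightarrow> a \<noteq> 0 \<Longrightarrow> b \<noteq> 0 \<Longrightarrow>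
      ord_integer p (a * b) = ord_integer p a + ord_integer p b"
proof -
  obtain g \<pi> where g: "\<pi> \<in> p" "g * \<pi> \<notin> p" "\<And>a. a \<in> p \<Longrightarrow> algebraic_int (g * a)"
    using exists_inverse_generator by blast
  \<comment> \<open>Each of the \<open>n\<close> factors from \<open>p\<close> absorbs one factor
    \<open>g\<close>.\<close>
  have pow_imp: "algebraic_int (g ^ n * a)" if "a \<in> pow n" for a n
    using that
  proof (induction n arbitrary: a)
    case 0
    thus ?case unfolding pow_0 by simp
  next
    case (Suc n)
    from Suc.prems show ?case
      unfolding pow_Suc
    proof (induction a rule: ideal_prod.induct)
      case (prod i j)
      have "algebraic_int ((g ^ n * i) * (g * j))"
        by (intro algebraic_int_times Suc.IH prod g)
      thus ?case by (simp add: mult_ac)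
    next
      case (sum a b)
      thus ?case by (simp add: distrib_left algebraic_int_plus del: power_Suc)
    qed
  qed
  have pow_iff: "a \<in> pow n \<longleftrightarrow> algebraic_int a \<and> algebraic_int (g ^ n * a)" for a n
  proof (intro iffI conjI)
    assume a: "algebraic_int a \<and> algebraic_int (g ^ n * a)"
    \<comment> \<open>Multiplying \<open>g ^ n * a\<close> by \<open>\<pi> ^ n\<close> leads into
      \<open>pow n\<close>; the factor \<open>(g * \<pi>) ^ n\<close> is outside \<open>p\<close>
      and can be cancelled.\<close>
    have "algebraic_int (g * \<pi>)" using g by blast
    moreover have "\<pi> ^ n \<in> pow n" by (rule power_mem_pow[OF g(1)])
    hence "(g ^ n * a) * \<pi> ^ n \<in> pow n" by (rule pow_mult[OF _ conjunct2[OF a]])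
    hence "(g * \<pi>) ^ n * a \<in> pow n" by (simp add: power_mult_distrib mult_ac)
    ultimately show "a \<in> pow n"
      using a g(2) power_mem pow_cancel[OF algebraic_int_power] by blast
  qed (auto intro: pow_imp pow_integral)
  \<comment> \<open>If \<open>g * t\<close> were integral, \<open>(g * \<pi>) * t\<close> would be a
    multiple of \<open>\<pi>\<close> and lie in \<open>p\<close>, although neither factor
    does.\<close>
  have g_not: "\<not> algebraic_int (g * t)" if t: "algebraic_int t" "t \<notin> p" for t
  proof
    assume "algebraic_int (g * t)"
    hence "(g * t) * \<pi> \<in> p" using g(1) by (rule mult_mem[rotated])
    hence "(g * \<pi>) * t \<in> p" by (simp add: mult_ac)
    thus False using prime_mem[of "g * \<pi>" t] g t by blast
  qed
  have pow_decr: "pow n \<subseteq> pow m" if "m \<le> n" for m n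
    using that
  proof (induction n rule: dec_induct)
    case (step n)
    thus ?case using prime.ideal_prod_inter[OF pow_ideal prime.is_ideal, of n] unfolding pow_Suc by blast
  qed simp
  define val where "val a n \<longleftrightarrow> algebraic_int a \<and> algebraic_int (g ^ n * a) \<and> g ^ n * a \<notin> p" for a n
  have val_pow: "a \<in> pow m \<longleftrightarrow> m \<le> n" if "val a n" for a n m
  proof
    assume "m \<le> n"
    thus "a \<in> pow m" using that pow_decr pow_iff unfolding val_def by blast
  next
    assume a: "a \<in> pow m"
    show "m \<le> n"
    proof (rule ccontr)
      assume "\<not> m \<le> n"
      hence "a \<in> pow (Suc n)" using a pow_decr[of "Suc n" m] by auto
      hence "algebraic_int (g ^ Suc n * a)" unfolding pow_iff by blast
      hence "algebraic_int (g * (g ^ n * a))" by (simp add: mult.assoc)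
      thus False using that g_not unfolding val_def by blast
    qed
  qed
  have val_ord: "ord_integer p a = n" if "val a n" for a n
    unfolding ord_integer_def by (rule Greatest_equality) (use val_pow[OF that] in blast)+
  have val_ex: "val a (ord_integer p a)" if a: "algebraic_int a" "a \<noteq> 0" for a
  proof -
    obtain k where k: "k > 0" "algebraic_int (of_nat k * inverse a)"
      by (rule exists_integer_denominator[OF nf, of "inverse a"])
    \<comment> \<open>If all \<open>g ^ n * a\<close> were integral, a denominator \<open>k\<close>
      of the inverse of \<open>a\<close> would make all \<open>k * g ^ n\<close> integral. Then
      \<open>g\<close> would be integral, and \<open>g * \<pi>\<close> would lie in
      \<open>p\<close>.\<close>
    have ex: "\<exists>n. \<not> algebraic_int (g ^ n * a)"
    proof (rule ccontr)
      assume neg: "\<not> ?thesis"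
      have "algebraic_int (of_nat k * g ^ n)" for n
      proof -
        have "algebraic_int (of_nat k * inverse a * (g ^ n * a))"
          using algebraic_int_times[OF k(2)] neg by blast
        moreover have "of_nat k * inverse a * (g ^ n * a) = of_nat k * g ^ n" using a(2) by simp
        ultimately show ?thesis by (simp only:)
      qed
      hence "algebraic_int g" by (rule algebraic_int_if_almost_integral[OF nf k(1)])
      thus False using g(1,2) mult_mem by blast
    qed
    \<comment> \<open>The exponent just before \<open>n\<close> is the order: there the product is
      still integral, and it is outside \<open>p\<close> because one more factor \<open>g\<close>
      destroys integrality.\<close>
    define n where "n = (LEAST n. \<not> algebraic_int (g ^ n * a))"
    have n: "\<not> algebraic_int (g ^ n * a)"
      unfolding n_def by (rule LeastI_ex[OF ex])
    hence "n \<noteq> 0" using a(1) by (intro notI) simp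
    then obtain n' where n': "n = Suc n'" by (cases n) auto
    have "algebraic_int (g ^ n' * a)"
      using not_less_Least[of n' "\<lambda>n. \<not> algebraic_int (g ^ n * a)"] n' unfolding n_def by auto
    moreover from this have "g ^ n' * a \<notin> p"
      using n g(3)[of "g ^ n' * a"] by (auto simp: n' mult.assoc)
    ultimately have "val a n'" using a(1) by (simp add: val_def)
    thus ?thesis using val_ord by simp
  qed
  show "a \<in> pow n \<longleftrightarrow> n \<le> ord_integer p a" if "algebraic_int a" "a \<noteq> 0" for a n
    by (rule val_pow[OF val_ex[OF that]])
  show "ord_integer p (a * b) = ord_integer p a + ord_integer p b"
    if "algebraic_int a" "algebraic_int b" "a \<noteq> 0" "b \<noteq> 0" for a b
  proof (rule val_ord)
    note v = val_ex[OF that(1,3)] val_ex[OF that(2,4)]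
    have *: "g ^ (ord_integer p a + ord_integer p b) * (a * b) =
        (g ^ ord_integer p a * a) * (g ^ ord_integer p b * b)"
      by (simp add: power_add mult_ac)
    show "val (a * b) (ord_integer p a + ord_integer p b)"
      unfolding val_def *
    proof (intro conjI)
      show "(g ^ ord_integer p a * a) * (g ^ ord_integer p b * b) \<notin> p"
        using v prime_mem unfolding val_def by blast
    qed (use v in \<open>auto simp: val_def intro: algebraic_int_times\<close>)
  qed
qed

lemma ord_integer_add:
  assumes "algebraic_int a" "algebraic_int b" "a \<noteq> 0" "b \<noteq> 0" "a + b \<noteq> 0"
  shows "min (ord_integer p a) (ord_integer p b) \<le> ord_integer p (a + b)"
proof -
  let ?n = "min (ord_integer p a) (ord_integer p b)"
  have "a \<in> pow ?n" "b \<in> pow ?n" using assms by (auto simp: mem_pow_iff)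
  hence "a + b \<in> pow ?n" by (rule pow_add)
  thus ?thesis using assms by (simp add: mem_pow_iff algebraic_int_plus)
qed

text \<open>The description by \<open>THE\<close> is independent of the fraction: cross-multiply and
  compare the orders of the two products.\<close>

lemma ord_prime_divide:
  assumes "algebraic_int a" "algebraic_int b" "a \<noteq> 0" "b \<noteq> 0"
  shows "ord_prime p (a / b) = int (ord_integer p a) - int (ord_integer p b)"
  unfolding ord_prime_def
proof (rule the_equality)
  show "\<exists>a'\<in>carrier ring_of_integers. \<exists>b'\<in>carrier ring_of_integers. a' \<noteq> 0 \<and> b' \<noteq> 0 \<and> a / b = a' / b' \<and>
    int (ord_integer p a) - int (ord_integer p b) = int (ord_integer p a') - int (ord_integer p b')"
    using assms by (intro bexI[of _ a] bexI[of _ b]) auto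
  fix k assume "\<exists>a'\<in>carrier ring_of_integers. \<exists>b'\<in>carrier ring_of_integers. a' \<noteq> 0 \<and> b' \<noteq> 0 \<and>
    a / b = a' / b' \<and> k = int (ord_integer p a') - int (ord_integer p b')"
  then obtain a' b' where *: "algebraic_int a'" "algebraic_int b'" "a' \<noteq> 0" "b' \<noteq> 0"
    "a / b = a' / b'" "k = int (ord_integer p a') - int (ord_integer p b')" by auto
  have "a * b' = a' * b" using * assms by (simp add: field_simps)
  hence "ord_integer p a + ord_integer p b' = ord_integer p a' + ord_integer p b"
    using ord_integer_mult * assms by metis
  thus "k = int (ord_integer p a) - int (ord_integer p b)" using * by simp
qed

lemma obtain_fraction:
  obtains a b where "algebraic_int a" "algebraic_int b" "b \<noteq> 0" "x = a / (b :: 'a)"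
proof -
  obtain m where "m > 0" "algebraic_int (of_nat m * x)"
    by (rule exists_integer_denominator[OF nf, of x])
  thus ?thesis using that[of "of_nat m * x" "of_nat m"] by simp
qed

lemma ord_prime_mult:
  assumes "x \<noteq> 0" "y \<noteq> 0"
  shows "ord_prime p (x * y) = ord_prime p x + ord_prime p y"
proof -
  obtain a b where x: "algebraic_int a" "algebraic_int b" "b \<noteq> 0" "x = a / b" by (rule obtain_fraction)
  obtain c d where y: "algebraic_int c" "algebraic_int d" "d \<noteq> 0" "y = c / d" by (rule obtain_fraction)
  have nz: "a \<noteq> 0" "c \<noteq> 0" using assms x y by auto
  have "ord_prime p (x * y) = ord_prime p ((a * c) / (b * d))" using x y by simp
  also have "\<dots> = int (ord_integer p (a * c)) - int (ord_integer p (b * d))"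
    using x y nz by (intro ord_prime_divide) (auto intro: algebraic_int_times)
  finally show ?thesis
    using x y nz by (simp add: ord_prime_divide ord_integer_mult)
qed

lemma ord_prime_add:
  assumes "x \<noteq> 0" "y \<noteq> 0" "x + y \<noteq> 0"
  shows "min (ord_prime p x) (ord_prime p y) \<le> ord_prime p (x + y)"
proof -
  obtain a b where x: "algebraic_int a" "algebraic_int b" "b \<noteq> 0" "x = a / b" by (rule obtain_fraction)
  obtain c d where y: "algebraic_int c" "algebraic_int d" "d \<noteq> 0" "y = c / d" by (rule obtain_fraction)
  define u v w where "u = a * d" and "v = c * b" and "w = b * d"
  have xy: "x = u / w" "y = v / w" using x y by (simp_all add: u_def v_def w_def)
  have int: "algebraic_int u" "algebraic_int v" "algebraic_int w"
    using x y by (auto simp: u_def v_def w_def intro: algebraic_int_times)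
  have sum: "x + y = (u + v) / w" using xy by (simp add: add_divide_distrib)
  have nz: "u \<noteq> 0" "v \<noteq> 0" "w \<noteq> 0" "u + v \<noteq> 0" using assms xy sum by auto
  have "min (ord_integer p u) (ord_integer p v) \<le> ord_integer p (u + v)"
    using int nz by (intro ord_integer_add)
  thus ?thesis using int nz unfolding sum unfolding xy by (simp add: ord_prime_divide algebraic_int_plus)
qed

section \<open>The absolute value of a finite place\<close>

lemma place_abs_mult: "place_abs (Fin_Place p) (x * y) = place_abs (Fin_Place p) x * place_abs (Fin_Place p) y"
  by (auto simp: ord_prime_mult diff_divide_distrib simp flip: powr_add)

text \<open>
  The case \<open>ideal_norm p = 0\<close> stands for an infinite residue ring and need not be excluded, since all
  absolute values vanish then.
\<close>

lemma place_abs_add: "place_abs (Fin_Place p) (x + y) \<le> max (place_abs (Fin_Place p) x) (place_abs (Fin_Place p) y)"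
proof (cases "x = 0 \<or> y = 0 \<or> x + y = 0 \<or> ideal_norm p = 0")
  case True
  thus ?thesis by (auto simp: le_max_iff_disj)
next
  case False
  hence "min (ord_prime p x) (ord_prime p y) \<le> ord_prime p (x + y)" by (intro ord_prime_add) auto
  hence "ord_prime p x \<le> ord_prime p (x + y) \<or> ord_prime p y \<le> ord_prime p (x + y)" by auto
  moreover have "real (ideal_norm p) powr (- real_of_int k / e) \<le> real (ideal_norm p) powr (- real_of_int l / e)"
    if "l \<le> k" "e \<ge> 0" for k l e
    using that False by (intro powr_mono divide_right_mono) auto
  ultimately show ?thesis
    using False by (auto simp: le_max_iff_disj)
qed

lemma place_abs_nonneg: "place_abs (Fin_Place p) x \<ge> 0"
  by simp

end

section \<open>Finiteness of the set of relevant primes\<close>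

text \<open>A prime containing \<open>m\<close> is a union of classes modulo \<open>m\<close>, hence
  determined by the representatives in \<open>F\<close> that it contains.\<close>

lemma finite_primes_containing:
  assumes nf: "number_field TYPE('a::field_char_0)" and "m > 0"
  shows "finite {p \<in> finite_primes. (of_nat m :: 'a) \<in> p}"
proof -
  obtain F where F: "finite F" "\<And>a::'a. algebraic_int a \<Longrightarrow> \<exists>f\<in>F. algebraic_int ((a - f) / of_nat m)"
    using finite_residues[OF nf assms(2)] by blast
  have "p \<subseteq> q" if p: "p \<in> finite_primes" "of_nat m \<in> p" and q: "q \<in> finite_primes" "of_nat m \<in> q"
    and eq: "p \<inter> F = q \<inter> F" for p q :: "'a set"
  proof
    fix x assume x: "x \<in> p"
    interpret p: number_field_prime p using nf p by unfold_locales
    interpret q: number_field_prime q using nf q by unfold_locales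
    obtain f where f: "f \<in> F" "algebraic_int ((x - f) / of_nat m)" using F(2) p.integral[OF x] by blast
    define w where "w = (x - f) / of_nat m"
    have w: "algebraic_int w" "x - f = w * of_nat m" using f(2) assms(2) by (auto simp: w_def)
    have "x - w * of_nat m \<in> p" using x p.mult_mem[OF p(2) w(1)] by (rule p.diff_mem)
    hence "f \<in> p" by (simp flip: w(2))
    hence "f \<in> q" using eq f(1) by blast
    hence "f + w * of_nat m \<in> q" using q.mult_mem[OF q(2) w(1)] by (rule q.add_mem)
    thus "x \<in> q" by (simp flip: w(2))
  qed
  hence "inj_on (\<lambda>p. p \<inter> F) {p \<in> finite_primes. (of_nat m :: 'a) \<in> p}"
    by (intro inj_onI equalityI) auto
  moreover have "(\<lambda>p. p \<inter> F) ` {p \<in> finite_primes. (of_nat m :: 'a) \<in> p} \<subseteq> Pow F" by auto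
  ultimately show ?thesis using F(1) by (meson finite_Pow_iff inj_on_finite)
qed

text \<open>Where the absolute value of \<open>x\<close> exceeds 1, the order of \<open>x\<close> is
  negative, so the prime contains every denominator \<open>m\<close> of \<open>x\<close>.\<close>

lemma finite_places_gt_1:
  fixes x :: "'a::field_char_0"
  assumes nf: "number_field TYPE('a)"
  shows "finite {p \<in> finite_primes. place_abs (Fin_Place p) x > 1}"
proof (cases "x = 0")
  case False
  obtain m where m: "m > 0" "algebraic_int (of_nat m * x)"
    by (rule exists_integer_denominator[OF nf, of x])
  have "of_nat m \<in> p" if P: "p \<in> finite_primes" "place_abs (Fin_Place p) x > 1" for p
  proof -
    interpret number_field_prime p using nf P(1) by unfold_locales
    have "ord_prime p x < 0"
    proof (rule ccontr)
      assume "\<not> ?thesis"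
      \<comment> \<open>The exponent is nonpositive. If \<open>ideal_norm p = 0\<close>, the power
        is 0 by the convention for \<open>powr\<close>.\<close>
      hence "real (ideal_norm p) powr (- real_of_int (ord_prime p x) / (real (ramification_index p) * real (residue_degree p))) \<le> 1"
        using powr_mono[of "- real_of_int (ord_prime p x) / (real (ramification_index p) * real (residue_degree p))"
            0 "real (ideal_norm p)"]
        by (cases "ideal_norm p = 0") (auto intro: divide_nonpos_nonneg)
      thus False using P(2) False by simp
    qed
    moreover have "ord_prime p (of_nat m * x / of_nat m) =
        int (ord_integer p (of_nat m * x)) - int (ord_integer p (of_nat m))"
      using m False by (intro ord_prime_divide) auto
    ultimately have "1 \<le> ord_integer p (of_nat m)" using m(1) by simp
    hence "of_nat m \<in> pow 1" using m(1) by (subst mem_pow_iff) auto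
    thus ?thesis using pow_1 by simp
  qed
  hence "{p \<in> finite_primes. place_abs (Fin_Place p) x > 1} \<subseteq> {p \<in> finite_primes. of_nat m \<in> p}" by blast
  thus ?thesis using finite_primes_containing[OF nf m(1)] by (rule finite_subset)
qed simp


section \<open>Absolute values of preperiodic points\<close>

text \<open>\<open>M\<close> is the maximum of \<open>N\<close> over the finite orbit, attained at
  some \<open>x\<close>, and \<open>z = x ^ 2 + c\<close> is the next orbit point. Only
  multiplicativity enters, so this serves finite and archimedean places alike.\<close>

lemma preperiodic_max_abs:
  fixes c P :: "'a::field_char_0" and N :: "'a \<Rightarrow> real"
  assumes "preperiodic (\<lambda>z. z ^ 2 + c) P" and "\<And>x y. N (x * y) = N x * N y"
  obtains M z where "N P \<le> M" "M\<^sup>2 = N (z - c)" "N z \<le> M"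
proof -
  define S where "S = range (\<lambda>n. ((\<lambda>z. z ^ 2 + c) ^^ n) P)"
  have S: "finite S" "P \<in> S"
    using assms(1) by (auto simp: S_def preperiodic_def intro!: image_eqI[of _ _ 0])
  have step: "x ^ 2 + c \<in> S" if "x \<in> S" for x
  proof -
    obtain n where "x = ((\<lambda>z. z ^ 2 + c) ^^ n) P" using \<open>x \<in> S\<close> by (auto simp: S_def)
    hence "x ^ 2 + c = ((\<lambda>z. z ^ 2 + c) ^^ Suc n) P" by simp
    thus ?thesis unfolding S_def by blast
  qed
  have "Max (N ` S) \<in> N ` S" using S by (intro Max_in) auto
  then obtain x where x: "x \<in> S" "N x = Max (N ` S)" by auto
  have max: "N y \<le> N x" if "y \<in> S" for y
    using S that by (simp add: x(2))
  show ?thesis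
  proof (rule that)
    show "N P \<le> N x" by (rule max[OF S(2)])
    show "(N x)\<^sup>2 = N (x ^ 2 + c - c)" by (simp add: power2_eq_square assms(2))
    show "N (x ^ 2 + c) \<le> N x" by (rule max[OF step[OF x(1)]])
  qed
qed

lemma powr_half_power: "x \<ge> 0 \<Longrightarrow> (x powr (1/2)) ^ n = (x ^ n) powr (1/2)"
  for x :: real
  by (simp add: powr_half_sqrt real_sqrt_power)

lemma preperiodic_place_abs_fin:
  fixes c P :: "'a::field_char_0"
  assumes nf: "number_field TYPE('a)" and pre: "preperiodic (\<lambda>z. z ^ 2 + c) P"
    and p: "p \<in> finite_primes"
  shows "max (place_abs (Fin_Place p) P) 1 \<le> max (place_abs (Fin_Place p) c) 1 powr (1 / 2)"
proof -
  interpret number_field_prime p using nf p by unfold_locales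
  define N where "N = place_abs (Fin_Place p)"
  obtain M z where M: "N P \<le> M" "M\<^sup>2 = N (z - c)" "N z \<le> M"
    by (rule preperiodic_max_abs[OF pre, of N]) (use place_abs_mult in \<open>simp_all add: N_def\<close>)
  \<comment> \<open>The squares of \<open>N 1\<close> and \<open>N (- 1)\<close> both equal
    \<open>N 1\<close>, and both values are nonnegative. This argument also covers an
    \<open>N\<close> that vanishes identically.\<close>
  have minus: "N (- c) = N c"
  proof -
    have "N 1 * N 1 = N 1" "N (- 1) * N (- 1) = N 1"
      unfolding N_def using place_abs_mult[of 1 1] place_abs_mult[of "- 1" "- 1"] by simp_all
    moreover have "N 1 \<ge> 0" "N (- 1) \<ge> 0" by (simp_all only: N_def place_abs_nonneg)
    ultimately have "N (- 1) = N 1" by (metis mult_cancel_right1 mult_eq_0_iff power2_eq_iff_nonneg power2_eq_square)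
    moreover have "N (- c) = N (- 1) * N c" "N c = N 1 * N c"
      unfolding N_def using place_abs_mult[of "- 1" c] place_abs_mult[of 1 c] by simp_all
    ultimately show ?thesis by simp
  qed
  have "M\<^sup>2 \<le> max M (N c)"
    using place_abs_add[of z "- c"] M minus unfolding N_def[symmetric] by auto
  moreover have "M \<le> sqrt (max (N c) 1)" if "M\<^sup>2 \<le> max (N c) 1"
    using that by (rule real_le_rsqrt)
  moreover have "M \<le> 1" if "M\<^sup>2 \<le> M" 
    using that by (rule_tac ccontr) (simp add: power2_eq_square)
  ultimately have "M \<le> sqrt (max (N c) 1)"
    by (smt (verit) real_sqrt_ge_1_iff)
  thus ?thesis using M(1) by (simp add: powr_half_sqrt flip: N_def)
qed

text \<open>With \<open>s\<^sup>2 = max (N c) 1\<close> the maximum satisfies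
  \<open>M\<^sup>2 - M \<le> s\<^sup>2\<close>. By the equation of the golden ratio, X^2 - X is at
  least \<open>s\<^sup>2\<close> at \<open>X = \<phi> * s\<close>, and it increases from there
  on.\<close>

lemma preperiodic_cmod:
  fixes c P :: "'a::field_char_0" and \<sigma> :: "'a \<Rightarrow> complex"
  assumes pre: "preperiodic (\<lambda>z. z ^ 2 + c) P"
    and hom: "\<And>x y. \<sigma> (x * y) = \<sigma> x * \<sigma> y" "\<And>x y. \<sigma> (x - y) = \<sigma> x - \<sigma> y"
  shows "max (cmod (\<sigma> P)) 1 \<le> (1 + sqrt 5) / 2 * max (cmod (\<sigma> c)) 1 powr (1 / 2)"
proof -
  define N where "N = (\<lambda>x. cmod (\<sigma> x))"
  obtain M z where M: "N P \<le> M" "M\<^sup>2 = N (z - c)" "N z \<le> M"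
    by (rule preperiodic_max_abs[OF pre, of N]) (simp_all add: N_def hom norm_mult)
  define s where "s = sqrt (max (N c) 1)"
  have s: "s \<ge> 1" "s\<^sup>2 = max (N c) 1" by (simp_all add: s_def)
  define \<phi> :: real where "\<phi> = (1 + sqrt 5) / 2"
  have phi: "\<phi>\<^sup>2 = \<phi> + 1" "\<phi> \<ge> 1"
    by (auto simp: \<phi>_def power2_eq_square field_simps)
  have "N (z - c) \<le> N z + N c" unfolding N_def hom by (rule norm_triangle_ineq4)
  hence M2: "M\<^sup>2 \<le> M + s\<^sup>2" using M s by linarith
  have "M \<le> \<phi> * s"
  proof (rule ccontr)
    assume "\<not> ?thesis"
    hence gt: "M > \<phi> * s" by simp
    have "\<phi> * s \<ge> s" using phi(2) s(1) by (simp add: mult_le_cancel_right1)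
    \<comment> \<open>This product is the difference of the values of X^2 - X at \<open>M\<close>
      and at \<open>\<phi> * s\<close>.\<close>
    hence "(M - \<phi> * s) * (M + \<phi> * s - 1) > 0"
      using gt s by (intro mult_pos_pos) linarith+
    moreover have "(M - \<phi> * s) * (M + \<phi> * s - 1) = M\<^sup>2 - M - \<phi>\<^sup>2 * s\<^sup>2 + \<phi> * s"
      by (simp add: algebra_simps power2_eq_square)
    moreover have "\<phi>\<^sup>2 * s\<^sup>2 - \<phi> * s = s\<^sup>2 + \<phi> * (s * (s - 1))"
      unfolding phi(1) by (simp add: algebra_simps power2_eq_square)
    moreover have "\<phi> * (s * (s - 1)) \<ge> 0" using phi(2) s(1) by simp
    ultimately show False using M2 by linarith
  qed
  moreover have "1 \<le> \<phi> * s" using phi(2) s(1) mult_mono[of 1 \<phi> 1 s] by simp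
  ultimately show ?thesis
    using M(1) by (simp add: \<phi>_def s_def N_def powr_half_sqrt)
qed


section \<open>Archimedean places\<close>

lemma embedding_simps:
  assumes "\<sigma> \<in> embeddings"
  shows "\<sigma> (x * y) = \<sigma> x * \<sigma> y" "\<sigma> (x + y) = \<sigma> x + \<sigma> y" "\<sigma> 1 = 1"
    "\<sigma> 0 = 0" "\<sigma> (- x) = - \<sigma> x" "\<sigma> (x - y) = \<sigma> x - \<sigma> y"
    "\<sigma> (of_nat n) = of_nat n" "\<sigma> (of_int k) = of_int k" "\<sigma> (x ^ n) = \<sigma> x ^ n"
    "\<sigma> (sum f A) = (\<Sum>i\<in>A. \<sigma> (f i))"
proof -
  show mult: "\<sigma> (x * y) = \<sigma> x * \<sigma> y" for x y
    using ring_hom_mult[of \<sigma> ring_of_type_algebra ring_of_type_algebra x y] assms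
    by (simp add: embeddings_def)
  show add: "\<sigma> (x + y) = \<sigma> x + \<sigma> y" for x y
    using ring_hom_add[of \<sigma> ring_of_type_algebra ring_of_type_algebra x y] assms
    by (simp add: embeddings_def)
  show one: "\<sigma> 1 = 1"
    using ring_hom_one[of \<sigma> ring_of_type_algebra ring_of_type_algebra] assms
    by (simp add: embeddings_def)
  show zero: "\<sigma> 0 = 0" using add[of 0 0] by simp
  show minus: "\<sigma> (- x) = - \<sigma> x" for x using add[of x "- x"] zero by (simp add: eq_neg_iff_add_eq_0 add.commute)
  show "\<sigma> (x - y) = \<sigma> x - \<sigma> y" using add[of x "- y"] minus by simp
  show of_nat: "\<sigma> (of_nat n) = of_nat n" for n by (induction n) (simp_all add: zero one add)
  show "\<sigma> (of_int k) = of_int k" by (cases k rule: int_cases2) (simp_all add: of_nat minus)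
  show "\<sigma> (x ^ n) = \<sigma> x ^ n" by (induction n) (simp_all add: one mult)
  show "\<sigma> (sum f A) = (\<Sum>i\<in>A. \<sigma> (f i))"
    by (induction A rule: infinite_finite_induct) (simp_all add: zero add)
qed

lemma cnj_embedding:
  assumes "\<sigma> \<in> embeddings" shows "cnj \<circ> \<sigma> \<in> embeddings"
  using assms by (auto simp: embeddings_def Ring.ring_hom_def)

lemma embedding_of_rat:
  assumes "\<sigma> \<in> embeddings" shows "\<sigma> (of_rat q) = of_rat q"
proof (cases q)
  case (Fract a b)
  have "\<sigma> (of_rat q) * of_int b = \<sigma> (of_rat q * of_int b)"
    by (simp add: embedding_simps[OF assms])
  also have "(of_rat q :: 'a) * of_int b = of_int a" using Fract by (simp add: of_rat_rat)
  finally show ?thesis using Fract by (simp add: embedding_simps[OF assms] of_rat_rat field_simps)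
qed

lemma of_real_of_rat: "complex_of_real (of_rat q) = of_rat q"
  by (cases q) (simp add: of_rat_rat)

lemma finitely_many_collisions:
  fixes a b :: complex
  assumes "a \<noteq> 0 \<or> b \<noteq> 0"
  shows "finite {t::nat. a + of_nat t * b = 0}"
proof (cases "b = 0")
  case False
  have "s = t" if "a + of_nat s * b = 0" "a + of_nat t * b = 0" for s t :: nat
  proof -
    have "of_nat s * b = of_nat t * b" using that by (metis add_left_cancel)
    thus ?thesis using False by simp
  qed
  hence "inj_on (\<lambda>_. ()) {t::nat. a + of_nat t * b = 0}" by (auto intro!: inj_onI)
  thus ?thesis by (rule inj_on_finite) auto
qed (use assms in auto)

text \<open>If \<open>\<theta>\<close> separates the old pairs and \<open>y\<close> the new one,
  then \<open>\<theta> + t * y\<close> separates all of them for all but finitely many natural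
  numbers \<open>t\<close>, since each pair excludes at most one \<open>t\<close>.\<close>

lemma exists_separating:
  assumes D: "finite D" "\<And>\<sigma> \<tau>. (\<sigma>, \<tau>) \<in> D \<Longrightarrow> \<sigma> \<in> embeddings \<and> \<tau> \<in> embeddings \<and> \<sigma> \<noteq> \<tau>"
  shows "\<exists>\<theta>::'a::field_char_0. \<forall>(\<sigma>, \<tau>)\<in>D. \<sigma> \<theta> \<noteq> \<tau> \<theta>"
  using D
proof (induction D rule: finite_induct)
  case (insert d D)
  obtain \<sigma> \<tau> where d: "d = (\<sigma>, \<tau>)" by force
  have emb: "\<sigma>' \<in> embeddings" "\<tau>' \<in> embeddings" if "(\<sigma>', \<tau>') \<in> insert d D" for \<sigma>' \<tau>'
    using insert.prems that by blast+
  obtain \<theta> where \<theta>: "\<forall>(\<sigma>, \<tau>)\<in>D. \<sigma> \<theta> \<noteq> \<tau> \<theta>" using insert by blast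
  have "\<sigma> \<noteq> \<tau>" using insert.prems d by blast
  then obtain y where y: "\<sigma> y \<noteq> \<tau> y" by blast
  define bad where "bad = (\<lambda>(\<sigma>, \<tau>). {t::nat. (\<sigma> \<theta> - \<tau> \<theta>) + of_nat t * (\<sigma> y - \<tau> y) = (0::complex)})"
  have "finite (bad e)" if "e \<in> insert d D" for e
  proof -
    obtain \<sigma>' \<tau>' where e: "e = (\<sigma>', \<tau>')" by force
    hence "\<sigma>' \<theta> - \<tau>' \<theta> \<noteq> 0 \<or> \<sigma>' y - \<tau>' y \<noteq> 0" using that \<theta> y d by auto
    thus ?thesis unfolding bad_def e prod.case by (rule finitely_many_collisions)
  qed
  hence "finite (\<Union>e\<in>insert d D. bad e)" using insert.hyps(1) by blast
  then obtain t where t: "t \<notin> (\<Union>e\<in>insert d D. bad e)" using ex_new_if_finite[OF infinite_UNIV_nat] by blast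
  have "\<sigma>' (\<theta> + of_nat t * y) \<noteq> \<tau>' (\<theta> + of_nat t * y)" if e: "(\<sigma>', \<tau>') \<in> insert d D" for \<sigma>' \<tau>'
  proof -
    have "t \<notin> bad (\<sigma>', \<tau>')" using t e by blast
    thus ?thesis using emb[OF e] by (auto simp: bad_def embedding_simps algebra_simps)
  qed
  thus ?case by blast
qed simp

text \<open>The images of a separating \<open>\<theta>\<close> under the embeddings in
  \<open>F\<close> are distinct roots of one nonzero polynomial of degree at most \<open>d\<close>,
  given by a relation between the powers of \<open>\<theta>\<close>. It is stated for finite
  \<open>F\<close> because the finiteness of the set of embeddings is derived from it.\<close>

lemma card_embeddings_le:
  assumes nf: "number_field TYPE('a::field_char_0)" and F: "finite F" "F \<subseteq> (embeddings :: ('a \<Rightarrow> complex) set)"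
  shows "card F \<le> field_degree TYPE('a)"
proof -
  define d where "d = field_degree TYPE('a)"
  define D where "D = {(\<sigma>, \<tau>) \<in> F \<times> F. \<sigma> \<noteq> \<tau>}"
  have "finite D" using F(1) unfolding D_def by (intro finite_subset[OF _ finite_cartesian_product[of F F]]) auto
  moreover have "\<sigma> \<in> embeddings \<and> \<tau> \<in> embeddings \<and> \<sigma> \<noteq> \<tau>" if "(\<sigma>, \<tau>) \<in> D" for \<sigma> \<tau>
    using that F(2) unfolding D_def by auto
  ultimately obtain \<theta> where \<theta>: "\<forall>(\<sigma>, \<tau>)\<in>D. \<sigma> \<theta> \<noteq> \<tau> \<theta>"
    using exists_separating[of D] by blast
  hence inj: "inj_on (\<lambda>\<sigma>. \<sigma> \<theta>) F" by (fastforce simp: inj_on_def D_def)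
  obtain c i where c: "i \<le> d" "c i \<noteq> 0" "(\<Sum>i\<le>d. of_int (c i) * \<theta> ^ i) = 0"
    using number_field_dependent[OF nf, of "\<lambda>i. \<theta> ^ i"] unfolding d_def by blast
  define q :: "complex poly" where "q = (\<Sum>i\<le>d. monom (of_int (c i)) i)"
  have coeff: "poly.coeff q j = (if j \<le> d then of_int (c j) else 0)" for j
    by (simp add: q_def coeff_sum sum.delta)
  have "q \<noteq> 0" using coeff[of i] c by auto
  have "Polynomial.degree q \<le> d" by (rule degree_le) (simp add: coeff)
  have root: "poly q (\<sigma> \<theta>) = 0" if "\<sigma> \<in> F" for \<sigma>
  proof -
    have emb: "\<sigma> \<in> embeddings" using that F(2) by blast
    have "poly q (\<sigma> \<theta>) = \<sigma> (\<Sum>i\<le>d. of_int (c i) * \<theta> ^ i)"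
      by (simp add: q_def poly_sum poly_monom embedding_simps[OF emb])
    also have "\<dots> = 0" unfolding c(3) by (rule embedding_simps(4)[OF emb])
    finally show ?thesis .
  qed
  have "card F = card ((\<lambda>\<sigma>. \<sigma> \<theta>) ` F)" using inj by (simp add: card_image)
  also have "\<dots> \<le> card {x. poly q x = 0}"
    using root poly_roots_finite[OF \<open>q \<noteq> 0\<close>] by (intro card_mono) auto
  also have "\<dots> \<le> Polynomial.degree q" by (rule card_poly_roots_bound[OF \<open>q \<noteq> 0\<close>])
  finally show ?thesis using \<open>Polynomial.degree q \<le> d\<close> by (simp add: d_def)
qed

lemma finite_embeddings:
  assumes "number_field TYPE('a::field_char_0)"
  shows "finite (embeddings :: ('a \<Rightarrow> complex) set)"
  using finite_if_finite_subsets_card_bdd[of embeddings "field_degree TYPE('a)", OF card_embeddings_le[OF assms]]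
  by simp

text \<open>Whichever of the two conjugate embeddings \<open>SOME\<close> selects, the modulus is
  the same.\<close>

lemma place_abs_arch: "place_abs (Arch_Place {\<sigma>, cnj \<circ> \<sigma>}) x = cmod (\<sigma> x)"
proof -
  have "(SOME \<tau>. \<tau> \<in> {\<sigma>, cnj \<circ> \<sigma>}) \<in> {\<sigma>, cnj \<circ> \<sigma>}" by (rule someI[of _ \<sigma>]) simp
  thus ?thesis by auto
qed

section \<open>The completion at an archimedean place\<close>

text \<open>\<open>A\<close> will be the image of the completion in the complex numbers; the real
  subfield corresponds to the completion of the rationals.\<close>

lemma dimension_Reals_complex:
  fixes A :: "complex set"
  assumes A: "A = \<real> \<or> A = UNIV"
  shows "ring.dimension (ring_of_type_algebra\<lparr>carrier := A\<rparr>) (if A = \<real> then 1 else 2) \<real> A"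
    and "subfield \<real> (ring_of_type_algebra\<lparr>carrier := A\<rparr>)"
    and "ring (ring_of_type_algebra\<lparr>carrier := A\<rparr>)"
proof -
  interpret C: field "ring_of_type_algebra :: complex ring" by (rule field_from_type_algebra)
  have Reals: "subfield \<real> (ring_of_type_algebra :: complex ring)"
    by (rule subfield_ring_of_type_algebraI) auto
  have A': "subfield A ring_of_type_algebra"
    by (rule subfield_ring_of_type_algebraI) (use A in auto)
  interpret A: field "ring_of_type_algebra\<lparr>carrier := A\<rparr>" using A' C.subfield_iff(2) by blast
  show "ring (ring_of_type_algebra\<lparr>carrier := A\<rparr>)" by (rule A.ring_axioms)
  show RA: "subfield \<real> (ring_of_type_algebra\<lparr>carrier := A\<rparr>)"
    by (rule A.subfield_iff(1)) (use C.subfield_iff(2)[OF Reals] A in auto)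
  show "A.dimension (if A = \<real> then 1 else 2) \<real> A"
  proof (cases "A = \<real>")
    case True
    thus ?thesis using A.dimension_one[OF RA] by simp
  next
    case False
    hence [simp]: "A = UNIV" using A by simp
    have "\<i> \<notin> \<real>" by (simp add: complex_is_Real_iff)
    hence "A.dimension (Suc 1) \<real> (A.line_extension \<real> \<i> \<real>)"
      by (intro A.Suc_dim A.dimension_one[OF RA]) auto
    moreover have "z \<in> A.line_extension \<real> \<i> \<real>" for z
      unfolding A.line_extension_mem_iff
      by (intro bexI[of _ "complex_of_real (Im z)"] bexI[of _ "complex_of_real (Re z)"])
        (auto simp: complex_eq_iff)
    hence "A.line_extension \<real> \<i> \<real> = UNIV" by blast
    ultimately show ?thesis using False by (simp add: numeral_2_eq_2)
  qed
qed

lemma real_limit_of_rats: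
  fixes \<sigma> :: "'a::field_char_0 \<Rightarrow> complex"
  assumes \<sigma>: "\<sigma> \<in> embeddings"
  obtains s :: "nat \<Rightarrow> 'a" where "range s \<subseteq> \<rat>" "(\<lambda>n. \<sigma> (s n)) \<longlonglongrightarrow> complex_of_real r"
proof -
  have "\<exists>q::rat. \<bar>of_rat q - r\<bar> < inverse (real (Suc n))" for n
  proof -
    obtain x where x: "x \<in> \<rat>" "r < x" "x < r + inverse (real (Suc n))"
      using Rats_dense_in_real[of r "r + inverse (real (Suc n))"] by auto
    from x(1) obtain q where "x = of_rat q" by (rule Rats_cases)
    with x have "\<bar>of_rat q - r\<bar> < inverse (real (Suc n))" by simp
    thus ?thesis by blast
  qed
  then obtain q :: "nat \<Rightarrow> rat" where q: "\<And>n. \<bar>of_rat (q n) - r\<bar> < inverse (real (Suc n))" by metis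
  have "(\<lambda>n. of_rat (q n) - r) \<longlonglongrightarrow> 0"
    using q by (intro LIMSEQ_norm_0) (simp add: inverse_eq_divide)
  hence "(\<lambda>n. of_rat (q n)) \<longlonglongrightarrow> r" by (rule LIM_zero_cancel)
  hence "(\<lambda>n. complex_of_real (of_rat (q n))) \<longlonglongrightarrow> complex_of_real r" by (rule tendsto_of_real)
  hence "(\<lambda>n. \<sigma> (of_rat (q n))) \<longlonglongrightarrow> complex_of_real r"
    by (simp only: embedding_of_rat[OF \<sigma>] of_real_of_rat)
  thus ?thesis by (intro that[of "\<lambda>n. of_rat (q n)"]) auto
qed

text \<open>Taking limits of \<open>\<sigma>\<close>-images maps the Cauchy sequences to the complex
  numbers, with the null sequences as kernel. So the completion is isomorphic to the image
  \<open>A\<close>, which is the real field if \<open>\<sigma>\<close> is real and the complex field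
  otherwise, and rational sequences have exactly the real limits.\<close>

lemma local_degree_arch:
  fixes \<sigma> :: "'a::field_char_0 \<Rightarrow> complex"
  assumes \<sigma>: "\<sigma> \<in> embeddings"
  shows "local_degree (Arch_Place {\<sigma>, cnj \<circ> \<sigma>}) = card {\<sigma>, cnj \<circ> \<sigma>}"
proof -
  define v where "v = Arch_Place {\<sigma>, cnj \<circ> \<sigma>}"
  note hom = embedding_simps[OF \<sigma>]
  have abs: "place_abs v x = cmod (\<sigma> x)" for x by (simp only: v_def place_abs_arch)
  let ?R = "cauchy_ring v"
  have carrier: "carrier ?R = {s. convergent (\<lambda>n. \<sigma> (s n))}"
    by (simp add: cauchy_ring_def abs hom Cauchy_convergent_iff[symmetric] Cauchy_def dist_norm)
  have R_simps: "s \<otimes>\<^bsub>?R\<^esub> t = (\<lambda>n. s n * t n)" "s \<oplus>\<^bsub>?R\<^esub> t = (\<lambda>n. s n + t n)"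
    "\<one>\<^bsub>?R\<^esub> = (\<lambda>_. 1)" "\<zero>\<^bsub>?R\<^esub> = (\<lambda>_. 0)" for s t
    by (simp_all add: cauchy_ring_def)
  have ringR: "ring ?R"
  proof (rule ringI)
    show "abelian_group ?R"
    proof (rule abelian_groupI)
      fix s assume s: "s \<in> carrier ?R"
      show "\<exists>t\<in>carrier ?R. t \<oplus>\<^bsub>?R\<^esub> s = \<zero>\<^bsub>?R\<^esub>"
        using s by (intro bexI[of _ "\<lambda>n. - s n"]) (auto simp: carrier R_simps hom convergent_minus_iff[symmetric])
    qed (auto simp: carrier R_simps hom convergent_add convergent_const algebra_simps)
    show "monoid ?R"
      by (rule monoidI) (auto simp: carrier R_simps hom convergent_mult convergent_const algebra_simps)
  qed (auto simp: R_simps algebra_simps)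
  define L where "L s = lim (\<lambda>n. \<sigma> (s n))" for s
  have L: "(\<lambda>n. \<sigma> (s n)) \<longlonglongrightarrow> L s" if "s \<in> carrier ?R" for s
    using that by (simp add: carrier L_def convergent_LIMSEQ_iff)
  have L_eq: "s \<in> carrier ?R \<and> L s = z" if "(\<lambda>n. \<sigma> (s n)) \<longlonglongrightarrow> z" for s z
    using that by (auto simp: carrier L_def limI convergentI)
  let ?C = "ring_of_type_algebra :: complex ring"
  have "L \<in> Ring.ring_hom ?R ?C"
  proof (rule ring_hom_memI)
    fix s t assume st: "s \<in> carrier ?R" "t \<in> carrier ?R"
    show "L (s \<otimes>\<^bsub>?R\<^esub> t) = L s \<otimes>\<^bsub>?C\<^esub> L t"
      using L_eq[of "\<lambda>n. s n * t n"] tendsto_mult[OF L[OF st(1)] L[OF st(2)]] by (simp add: R_simps hom)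
    show "L (s \<oplus>\<^bsub>?R\<^esub> t) = L s \<oplus>\<^bsub>?C\<^esub> L t"
      using L_eq[of "\<lambda>n. s n + t n"] tendsto_add[OF L[OF st(1)] L[OF st(2)]] by (simp add: R_simps hom)
  qed (use L_eq[of "\<lambda>_. 1" 1] in \<open>auto simp: R_simps hom\<close>)
  then interpret L: ring_hom_ring ?R ?C L
    using ringR ring_from_type_algebra by (intro ring_hom_ringI2) auto
  have ker: "a_kernel ?R ?C L = null_seqs v"
  proof -
    have "L s = 0 \<longleftrightarrow> (\<lambda>n. \<sigma> (s n)) \<longlonglongrightarrow> 0" if "s \<in> carrier ?R" for s
      using L[OF that] L_eq[of s 0] by auto
    moreover have "s \<in> carrier ?R" if "(\<lambda>n. \<sigma> (s n)) \<longlonglongrightarrow> 0" for s using L_eq[OF that] by blast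
    moreover have "s \<in> null_seqs v \<longleftrightarrow> (\<lambda>n. \<sigma> (s n)) \<longlonglongrightarrow> 0" for s
      unfolding null_seqs_def abs mem_Collect_eq by (rule tendsto_norm_zero_iff)
    ultimately show ?thesis
      unfolding a_kernel_def' ring_of_type_algebra_simps by blast
  qed
  have closed_Reals: "L s \<in> \<real>" if "s \<in> carrier ?R" "\<And>n. \<sigma> (s n) \<in> \<real>" for s
  proof -
    have "(\<lambda>n. Im (\<sigma> (s n))) \<longlonglongrightarrow> Im (L s)" by (rule tendsto_Im[OF L[OF that(1)]])
    moreover have "Im (\<sigma> (s n)) = 0" for n using that(2)[of n] by (simp add: complex_is_Real_iff)
    ultimately have "Im (L s) = 0" by (simp add: LIMSEQ_const_iff)
    thus ?thesis by (simp add: complex_is_Real_iff)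
  qed
  define A where "A = L ` carrier ?R"
  have rats: "L ` {s \<in> carrier ?R. range s \<subseteq> \<rat>} = \<real>"
  proof (intro equalityI subsetI)
    fix z assume "z \<in> L ` {s \<in> carrier ?R. range s \<subseteq> \<rat>}"
    then obtain s where s: "s \<in> carrier ?R" "range s \<subseteq> \<rat>" "z = L s" by auto
    have "\<sigma> (s n) \<in> \<real>" for n
    proof -
      obtain q where "s n = of_rat q" using s(2) by (auto elim: Rats_cases)
      thus ?thesis by (simp add: embedding_of_rat[OF \<sigma>] flip: of_real_of_rat)
    qed
    thus "z \<in> \<real>" using closed_Reals s by blast
  next
    fix z :: complex assume "z \<in> \<real>"
    then obtain r where r: "z = complex_of_real r" by (auto elim: Reals_cases)
    obtain s where s: "range s \<subseteq> \<rat>" "(\<lambda>n. \<sigma> (s n)) \<longlonglongrightarrow> complex_of_real r"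
      by (rule real_limit_of_rats[OF \<sigma>])
    thus "z \<in> L ` {s \<in> carrier ?R. range s \<subseteq> \<rat>}" using L_eq[OF s(2)] r by (intro image_eqI[of _ _ s]) auto
  qed
  have A: "A = (if cnj \<circ> \<sigma> = \<sigma> then \<real> else UNIV)"
  proof (cases "cnj \<circ> \<sigma> = \<sigma>")
    case True
    have "\<sigma> x \<in> \<real>" for x using fun_cong[OF True, of x] by (simp add: Reals_cnj_iff)
    hence "A \<subseteq> \<real>" unfolding A_def using closed_Reals by blast
    moreover have "\<real> \<subseteq> A" unfolding A_def rats[symmetric] by blast
    ultimately show ?thesis using True by auto
  next
    case False
    then obtain x where x: "\<sigma> x \<notin> \<real>" by (auto simp: fun_eq_iff Reals_cnj_iff)
    hence Im: "Im (\<sigma> x) \<noteq> 0" by (simp add: complex_is_Real_iff)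
    \<comment> \<open>As \<open>\<sigma> x\<close> is not real,
      \<open>z = a + b * \<sigma> x\<close> with real \<open>a\<close> and \<open>b\<close>, and
      both are limits of rational sequences.\<close>
    have "z \<in> A" for z
    proof -
      define b where "b = Im z / Im (\<sigma> x)"
      define a where "a = Re z - b * Re (\<sigma> x)"
      obtain s where s: "(\<lambda>n. \<sigma> (s n)) \<longlonglongrightarrow> complex_of_real a" by (rule real_limit_of_rats[OF \<sigma>])
      obtain t where t: "(\<lambda>n. \<sigma> (t n)) \<longlonglongrightarrow> complex_of_real b" by (rule real_limit_of_rats[OF \<sigma>])
      have "(\<lambda>n. \<sigma> (s n) + \<sigma> (t n) * \<sigma> x) \<longlonglongrightarrow> complex_of_real a + complex_of_real b * \<sigma> x"
        by (intro tendsto_add tendsto_mult s t tendsto_const)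
      moreover have "complex_of_real a + complex_of_real b * \<sigma> x = z"
        using Im by (simp add: complex_eq_iff a_def b_def)
      ultimately show ?thesis
        using L_eq[of "\<lambda>n. s n + t n * x" z] unfolding A_def by (force simp: hom)
    qed
    thus ?thesis using False by auto
  qed
  let ?d = "if A = \<real> then 1 else 2 :: nat"
  have "\<i> \<notin> \<real>" by (simp add: complex_is_Real_iff)
  hence "(\<real> :: complex set) \<noteq> UNIV" by blast
  hence d: "?d = card {\<sigma>, cnj \<circ> \<sigma>}" using A by (auto simp: card_insert_if)
  have "A = \<real> \<or> A = UNIV" using A by auto
  note dim = dimension_Reals_complex[OF this]
  let ?K = "completion v" and ?A = "ring_of_type_algebra\<lparr>carrier := A\<rparr>"
  let ?\<psi> = "\<lambda>S. the_elem (L ` S)"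
  have K: "?K = ?R Quot a_kernel ?R ?C L" by (simp add: completion_def ker)
  have iso: "?\<psi> \<in> ring_iso ?K ?A"
    using L.FactRing_iso_set_aux unfolding K A_def .
  interpret K: ring ?K unfolding K by (rule ideal.quotient_is_ring[OF L.kernel_is_ideal])
  \<comment> \<open>The inverse isomorphism carries the known dimension of \<open>A\<close> over the
    reals to the completion.\<close>
  define \<iota> where "\<iota> = inv_into (carrier ?K) ?\<psi>"
  have iota: "\<iota> \<in> ring_iso ?A ?K"
    unfolding \<iota>_def by (rule ring_iso_set_sym[OF K.ring_axioms iso])
  then interpret I: ring_hom_ring ?A ?K \<iota>
    using dim(3) K.ring_axioms by (intro ring_hom_ringI2) (auto simp: ring_iso_def)
  have bij: "bij_betw ?\<psi> (carrier ?K) A" "bij_betw \<iota> A (carrier ?K)"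
    using iso iota by (auto simp: ring_iso_def)
  have coset: "?\<psi> (null_seqs v +>\<^bsub>?R\<^esub> s) = L s \<and> null_seqs v +>\<^bsub>?R\<^esub> s \<in> carrier ?K" if "s \<in> carrier ?R" for s
    using L.the_elem_simp[OF that] that unfolding K ker[symmetric]
    by (auto simp: FactRing_def A_RCOSETS_def' )
  have "\<iota> (L s) = null_seqs v +>\<^bsub>?R\<^esub> s" if "s \<in> carrier ?R" for s
    using bij_betw_inv_into_left[OF bij(1) conjunct2[OF coset[OF that]]] coset[OF that]
    unfolding \<iota>_def by (simp only:)
  hence img: "\<iota> ` \<real> = completion_rats v" "\<iota> ` A = carrier ?K" "inj_on \<iota> A"
    using bij(2) unfolding completion_rats_def rats[symmetric] image_image bij_betw_def
    by (blast intro: image_cong)+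
  have "1 \<in> A" "0 \<in> A" using A by auto
  \<comment> \<open>The facts on images of subfields and dimensions are for homomorphisms into a
    ring with 1 \<noteq> 0.\<close>
  hence "\<iota> 1 \<noteq> \<iota> 0" using inj_on_eq_iff[OF img(3)] by simp
  hence nontrivial: "\<one>\<^bsub>?K\<^esub> \<noteq> \<zero>\<^bsub>?K\<^esub>" using I.hom_one I.hom_zero by simp
  have "subfield (completion_rats v) ?K" "K.dimension ?d (completion_rats v) (carrier ?K)"
    using I.img_is_subfield(2)[OF dim(2) nontrivial] I.inj_hom_dimension[OF dim(2) nontrivial img(3) dim(1)]
    unfolding img by blast+
  hence "K.dim (completion_rats v) (carrier ?K) = ?d"
    using K.dimI unfolding over_def by blast
  thus ?thesis unfolding local_degree_def v_def[symmetric] d .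
qed


section \<open>The height\<close>

text \<open>The sets of conjugate embeddings partition all embeddings and have the local degrees as
  sizes, so the sum is the number of embeddings.\<close>

lemma sum_local_degree_arch:
  assumes nf: "number_field TYPE('a::field_char_0)"
  defines "V \<equiv> {Arch_Place {\<sigma>, cnj \<circ> \<sigma>} | \<sigma> :: 'a \<Rightarrow> complex. \<sigma> \<in> embeddings}"
  shows "finite V" "(\<Sum>v\<in>V. local_degree v) \<le> field_degree TYPE('a)"
proof -
  let ?E = "embeddings :: ('a \<Rightarrow> complex) set"
  define Orb where "Orb = (\<lambda>\<sigma>. {\<sigma>, cnj \<circ> \<sigma>}) ` ?E"
  have fin: "finite ?E" by (rule finite_embeddings[OF nf])
  have V: "V = Arch_Place ` Orb" by (auto simp: V_def Orb_def)
  show "finite V" unfolding V Orb_def using fin by simp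
  have "(\<Sum>v\<in>V. local_degree v) = (\<Sum>S\<in>Orb. local_degree (Arch_Place S))"
    unfolding V by (subst sum.reindex) (auto simp: inj_on_def)
  also have "\<dots> = (\<Sum>S\<in>Orb. card S)"
    by (rule sum.cong) (auto simp: Orb_def local_degree_arch)
  also have "\<dots> = card (\<Union>Orb)"
  proof (rule card_Union_disjoint[symmetric])
    have cnj: "cnj \<circ> (cnj \<circ> \<sigma>) = \<sigma>" for \<sigma> :: "'a \<Rightarrow> complex" by (simp add: fun_eq_iff)
    have "{\<sigma>, cnj \<circ> \<sigma>} = {\<tau>, cnj \<circ> \<tau>}" if "{\<sigma>, cnj \<circ> \<sigma>} \<inter> {\<tau>, cnj \<circ> \<tau>} \<noteq> {}" for \<sigma> \<tau> :: "'a \<Rightarrow> complex"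
    proof -
      have "\<sigma> = \<tau> \<or> \<sigma> = cnj \<circ> \<tau> \<or> cnj \<circ> \<sigma> = \<tau> \<or> cnj \<circ> \<sigma> = cnj \<circ> \<tau>" using that by blast
      hence "\<sigma> = \<tau> \<or> \<sigma> = cnj \<circ> \<tau>" using cnj by metis
      thus ?thesis using cnj[of \<tau>] by auto
    qed
    thus "pairwise disjnt Orb" unfolding pairwise_def disjnt_def Orb_def by blast
  qed (auto simp: Orb_def)
  also have "\<Union>Orb = ?E" using cnj_embedding by (auto simp: Orb_def)
  also have "card ?E \<le> field_degree TYPE('a)" by (rule card_embeddings_le[OF nf fin]) simp
  finally show "(\<Sum>v\<in>V. local_degree v) \<le> field_degree TYPE('a)" .
qed

lemma prod_powr:
  fixes g :: "'b \<Rightarrow> real"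
  shows "(\<And>v. v \<in> T \<Longrightarrow> g v \<ge> 0) \<Longrightarrow> (\<Prod>v\<in>T. g v powr a) = (\<Prod>v\<in>T. g v) powr a"
  by (induction T rule: infinite_finite_induct) (simp_all add: powr_mult prod_nonneg)

theorem theorem4p8:
  fixes c P :: "'a::field_char_0"
  assumes "number_field TYPE('a)"
    and "preperiodic (\<lambda>z. z ^ 2 + c) P"
  shows "rel_height P \<le> ((1 + sqrt 5) / 2) ^ field_degree TYPE('a) * rel_height c powr (1 / 2)"
proof -
  define \<phi> :: real where "\<phi> = (1 + sqrt 5) / 2"
  have phi: "\<phi> \<ge> 1" by (simp add: \<phi>_def)
  define h where "h x v = max (place_abs v x) 1 ^ local_degree v" for x :: 'a and v
  define V where "V = {Arch_Place {\<sigma>, cnj \<circ> \<sigma>} | \<sigma> :: 'a \<Rightarrow> complex. \<sigma> \<in> embeddings}"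
  note V = sum_local_degree_arch[OF assms(1), folded V_def]
  \<comment> \<open>The finite places at which the factor of \<open>c\<close> can differ from
    1.\<close>
  define W where "W = Fin_Place ` {p \<in> finite_primes. place_abs (Fin_Place p) c > 1}"
  have "finite W" unfolding W_def using finite_places_gt_1[OF assms(1)] by blast
  with V(1) have fin: "finite (V \<union> W)" by simp
  have sub: "V \<union> W \<subseteq> places" by (auto simp: places_def V_def W_def)
  have h_ge: "h x v \<ge> 1" for x v by (simp add: h_def)
  have bound: "h P v \<le> (if v \<in> V then \<phi> ^ local_degree v else 1) * h c v powr (1 / 2)"
    if v: "v \<in> places" for v
  proof -
    have "max (place_abs v P) 1 \<le> (if v \<in> V then \<phi> else 1) * max (place_abs v c) 1 powr (1 / 2)"
    proof (cases "v \<in> V")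
      case True
      then obtain \<sigma> where \<sigma>: "\<sigma> \<in> embeddings" "v = Arch_Place {\<sigma>, cnj \<circ> \<sigma>}" by (auto simp: V_def)
      show ?thesis
        using preperiodic_cmod[OF assms(2), of \<sigma>] True
        unfolding \<sigma>(2) place_abs_arch \<phi>_def by (simp add: embedding_simps[OF \<sigma>(1)])
    next
      case False
      then obtain p where p: "p \<in> finite_primes" "v = Fin_Place p"
        using v by (auto simp: places_def V_def)
      show ?thesis using preperiodic_place_abs_fin[OF assms p(1)] False by (simp add: p(2) del: place_abs.simps)
    qed
    hence "h P v \<le> ((if v \<in> V then \<phi> else 1) * max (place_abs v c) 1 powr (1 / 2)) ^ local_degree v"
      unfolding h_def by (intro power_mono) auto
    also have "\<dots> = (if v \<in> V then \<phi> ^ local_degree v else 1) * h c v powr (1 / 2)"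
      by (simp add: power_mult_distrib powr_half_power h_def)
    finally show ?thesis .
  qed
  \<comment> \<open>Outside \<open>V\<close> and \<open>W\<close> the bound for \<open>P\<close> has
    no golden ratio and the factor of \<open>c\<close> is 1, so the factor of \<open>P\<close>,
    which is at least 1, equals 1 as well.\<close>
  have outside: "h c v = 1" "h P v = 1" if w: "v \<in> places - (V \<union> W)" for v
  proof -
    obtain p where p: "p \<in> finite_primes" "v = Fin_Place p"
      using w by (auto simp: places_def V_def)
    hence "place_abs v c \<le> 1" using w by (force simp: W_def simp del: place_abs.simps)
    thus c: "h c v = 1" by (simp add: h_def)
    have "h P v \<le> 1" using bound[of v] w c by auto
    thus "h P v = 1" using h_ge[of P v] by simp
  qed
  \<comment> \<open>This replaces \<open>prod'\<close> over all places by a finite product on which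
    factorwise estimates apply.\<close>
  have height: "rel_height x = (\<Prod>v\<in>V \<union> W. h x v)" if "\<forall>v\<in>places - (V \<union> W). h x v = 1" for x
    unfolding rel_height_def h_def[symmetric]
    using prod.mono_neutral_right'[OF sub that] prod.eq_sum[OF fin] by metis
  have "rel_height P = (\<Prod>v\<in>V \<union> W. h P v)" using outside by (intro height) blast
  also have "\<dots> \<le> (\<Prod>v\<in>V \<union> W. (if v \<in> V then \<phi> ^ local_degree v else 1) * h c v powr (1 / 2))"
    using bound[OF subsetD[OF sub]] order_trans[OF zero_le_one h_ge] by (intro prod_mono conjI)
  also have "\<dots> = (\<Prod>v\<in>V \<union> W. if v \<in> V then \<phi> ^ local_degree v else 1) * (\<Prod>v\<in>V \<union> W. h c v) powr (1 / 2)"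
    using h_ge by (simp only: prod.distrib) (subst prod_powr, auto intro: order_trans[OF zero_le_one])
  also have "(\<Prod>v\<in>V \<union> W. h c v) = rel_height c" using outside by (intro height[symmetric]) blast
  also have "(\<Prod>v\<in>V \<union> W. if v \<in> V then \<phi> ^ local_degree v else 1) = (\<Prod>v\<in>V. \<phi> ^ local_degree v)"
    using fin by (intro prod.mono_neutral_cong_right) auto
  also have "\<dots> = \<phi> ^ (\<Sum>v\<in>V. local_degree v)" by (simp add: power_sum)
  also have "\<dots> * rel_height c powr (1 / 2) \<le> \<phi> ^ field_degree TYPE('a) * rel_height c powr (1 / 2)"
    using phi V(2) by (intro mult_right_mono power_increasing) auto
  finally show ?thesis by (simp add: \<phi>_def)
qed

end
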